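(* Let $n\geq 3$, $p,q>0$ with $pq>1$, $\alpha\in(1,n)$ and $\sigma_1,\sigma_2\in[0,\alpha)$. Suppose the subcritical condition $$\frac{n-\sigma_1}{1+q}+\frac{n-\sigma_2}{1+p}>n-\alpha$$ holds. Then the system $$u(x)=\int_{\mathbb{R}^n}\frac{v(y)^q}{|x-y|^{n-\alpha}|y|^{\sigma_1}}\,dy,\qquad v(x)=\int_{\mathbb{R}^n}\frac{u(y)^p}{|x-y|^{n-\alpha}|y|^{\sigma_2}}\,dy,\qquad x\in\mathbb{R}^n,$$ admits no bounded and decaying positive classical solution.
   Context: A classical solution is a solution $u,v\in C^{\lfloor\alpha\rfloor}(\mathbb{R}^n\setminus\{0\})\cap C(\mathbb{R}^n)$, where $\lfloor\cdot\rfloor$ is the greatest integer function; positive means $u,v>0$. The notation $f(x)\simeq g(x)$ means there exist constants $c,C>0$ with $cg(x)\leq f(x)\leq Cg(x)$ as $|x|\to\infty$. A positive solution is called decaying if $u(x)\simeq|x|^{-\theta_1}$ and $v(x)\simeq|x|^{-\theta_2}$ for some $\theta_1,\theta_2>0$. *)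

theory Defs
  imports "HOL-Analysis.Analysis"
begin

fun Ck_on :: "nat \<Rightarrow> 'a::euclidean_space set \<Rightarrow> ('a \<Rightarrow> real) \<Rightarrow> bool" where
  "Ck_on 0 S f = continuous_on S f"
| "Ck_on (Suc k) S f =
     ((\<forall>x\<in>S. f differentiable (at x)) \<and>
      (\<forall>i\<in>Basis. Ck_on k S (\<lambda>x. frechet_derivative f (at x) i)))"

definition classical_fn :: "real \<Rightarrow> ('a::euclidean_space \<Rightarrow> real) \<Rightarrow> bool" where
  "classical_fn \<alpha> f \<longleftrightarrow> Ck_on (nat \<lfloor>\<alpha>\<rfloor>) (- {0}) f \<and> continuous_on UNIV f"

definition decays_like :: "('a::real_normed_vector \<Rightarrow> real) \<Rightarrow> real \<Rightarrow> bool" where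
  "decays_like f \<theta> \<longleftrightarrow> (\<exists>c C R. c > 0 \<and> C > 0 \<and>
      (\<forall>x. norm x \<ge> R \<longrightarrow> c * norm x powr (-\<theta>) \<le> f x \<and> f x \<le> C * norm x powr (-\<theta>)))"

end

theory Submission
  imports Defs
begin

text \<open>
  Write \<open>b = n - \<alpha>\<close>, and \<open>A(l)\<close>, \<open>B(l)\<close> for the integrals of \<open>u(l x) u(x)\<^sup>p |x|\<close> to the power \<open>-\<sigma>2\<close> and of
  \<open>v(l x)\<^sup>q v(x) |x|\<close> to the power \<open>-\<sigma>1\<close>. Scaling the first equation and applying Tonelli to the
  symmetric kernel gives \<open>A(l) = l powr (\<alpha> - \<sigma>1) * B(l)\<close>, an integral form of the Pohozaev identity; at
  \<open>l = 1\<close> both sides equal the same energy. Young's inequality bounds \<open>B(l)\<close> from above. It also bounds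
  \<open>A(l)\<close> from below up to an error of order \<open>(1 - l)\<^sup>2\<close>, because \<open>u\<close> is Lipschitz under dilations, with
  constant a multiple of \<open>u(x)\<close>; this is where \<open>\<alpha> > 1\<close> enters. Letting \<open>l\<close> tend to \<open>1\<close> from below
  contradicts subcriticality. The energy is finite because the trivial lower bound for the potentials
  forces \<open>\<theta>1 \<le> q \<theta>2 + \<sigma>1 - \<alpha>\<close> and \<open>\<theta>2 \<le> p \<theta>1 + \<sigma>2 - \<alpha>\<close>, which together with subcriticality
  yields \<open>\<theta>1 + \<theta>2 > n - \<alpha>\<close>.
\<close>

section \<open>Powers of the norm\<close>

lemma nn_integral_lborel_scale:
  fixes f :: "'a::euclidean_space \<Rightarrow> ennreal"
  assumes [measurable]: "f \<in> borel_measurable borel" and c: "c > 0"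
  shows "(\<integral>\<^sup>+ x. f x \<partial>lborel) = ennreal (c ^ DIM('a)) * (\<integral>\<^sup>+ x. f (c *\<^sub>R x) \<partial>lborel)"
  using c by (subst lborel_affine[of c 0])
    (simp_all add: nn_integral_density nn_integral_distr nn_integral_cmult)

lemma nn_integral_lborel_reflect:
  fixes f :: "'a::euclidean_space \<Rightarrow> ennreal"
  assumes [measurable]: "f \<in> borel_measurable borel"
  shows "(\<integral>\<^sup>+ y. f y \<partial>lborel) = (\<integral>\<^sup>+ y. f (x - y) \<partial>lborel)"
  by (subst lborel_affine[of "-1" x]) (simp_all add: nn_integral_density nn_integral_distr)

lemma le_suminf_ennreal: "f k \<le> (\<Sum>k. f k)" for f :: "nat \<Rightarrow> ennreal"
  using sum_le_suminf[of f "{k}"] by simp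

lemma powr_power_commute: "x > 0 \<Longrightarrow> (x ^ k) powr a = (x powr a) ^ k" for x a :: real
  by (simp add: powr_powr mult.commute flip: powr_realpow)

lemma powr_mult_power: "x > 0 \<Longrightarrow> x powr a * x ^ n = x powr (real n + a)" for x a :: real
  by (simp add: powr_add powr_realpow mult.commute)

text \<open>A nonzero \<open>y\<close> in the ball lies in a dyadic annulus with inner radius
  \<open>r * (1/2) ^ Suc k\<close> and outer radius \<open>r * (1/2) ^ k\<close>. There the term of
  index \<open>k\<close> alone dominates, since a negative power is largest at the inner radius. At
  the origin the left side is \<open>0\<close> by the convention for \<open>powr\<close>.\<close>

lemma powr_le_suminf_dyadic:
  fixes y :: "'a::real_normed_vector"
  assumes r: "r > 0" and s: "s \<ge> 0" and y: "y \<in> ball 0 r"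
  shows "ennreal (norm y powr (- s))
    \<le> (\<Sum>k. ennreal ((r * (1/2) ^ Suc k) powr (- s)) * indicator (ball 0 (r * (1/2) ^ k)) y)"
proof (cases "y = 0")
  case False
  define P where "P k \<longleftrightarrow> r * (1/2) ^ k \<le> norm y" for k
  have "(\<lambda>k. r * (1/2::real) ^ k) \<longlonglongrightarrow> r * 0"
    by (intro tendsto_intros LIMSEQ_power_zero) auto
  then have "eventually (\<lambda>k. r * (1/2::real) ^ k < norm y) sequentially"
    using False by (intro order_tendstoD(2)) auto
  then obtain k0 where "P k0"
    unfolding P_def eventually_sequentially by (meson less_imp_le order_refl)
  define m where "m = (LEAST k. P k)"
  have m: "P m" unfolding m_def by (rule LeastI[of P, OF \<open>P k0\<close>])
  have "\<not> P 0" using y by (simp add: P_def)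
  then obtain k where k: "m = Suc k" using m by (cases m) auto
  have "\<not> P k" using not_less_Least[of k P] k by (simp add: m_def)
  then have yk: "y \<in> ball 0 (r * (1/2) ^ k)" by (simp add: P_def)
  have "norm y powr (- s) \<le> (r * (1/2) ^ Suc k) powr (- s)"
    using m k r s by (intro powr_mono2') (auto simp: P_def)
  then have "ennreal (norm y powr (- s))
      \<le> ennreal ((r * (1/2) ^ Suc k) powr (- s)) * indicator (ball 0 (r * (1/2) ^ k)) y"
    using yk by (simp add: ennreal_leI)
  also have "\<dots> \<le> (\<Sum>k. ennreal ((r * (1/2) ^ Suc k) powr (- s)) * indicator (ball 0 (r * (1/2) ^ k)) y)"
    by (rule le_suminf_ennreal)
  finally show ?thesis .
qed simp

text \<open>Integrating the dyadic majorant gives a geometric series with ratio 2 to the power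
  \<open>s - n\<close>, which converges because \<open>s\<close> is below the dimension. Each
  annulus is replaced by its full ball, at the cost of a constant only. The constant does not depend
  on \<open>r\<close>.\<close>

lemma nn_integral_ball_powr_le:
  assumes s: "0 \<le> s" "s < real DIM('a::euclidean_space)"
  shows "\<exists>C\<ge>0. \<forall>r>0. (\<integral>\<^sup>+ y\<in>ball (0::'a) r. ennreal (norm y powr (- s)) \<partial>lborel)
           \<le> ennreal (C * r powr (real DIM('a) - s))"
proof -
  let ?n = "real DIM('a)"
  let ?V = "unit_ball_vol ?n"
  define \<rho> :: real where "\<rho> = 2 powr (s - ?n)"
  have \<rho>: "0 < \<rho>" "\<rho> < 1"
    using s powr_less_mono[of "s - ?n" 0 2] by (auto simp: \<rho>_def)
  \<comment> \<open>The factor \<open>2 powr s\<close> comes from replacing the norm by the inner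
    radius, half of the outer one. The rest is the volume of the unit ball and the sum of the
    geometric series.\<close>
  define C where "C = 2 powr s * ?V / (1 - \<rho>)"
  have "(\<integral>\<^sup>+ y\<in>ball (0::'a) r. ennreal (norm y powr (- s)) \<partial>lborel) \<le> ennreal (C * r powr (?n - s))"
    if r: "r > 0" for r
  proof -
    let ?g = "\<lambda>k y. ennreal ((r * (1/2) ^ Suc k) powr (- s)) * indicator (ball (0::'a) (r * (1/2) ^ k)) y"
    have "(\<integral>\<^sup>+ y\<in>ball (0::'a) r. ennreal (norm y powr (- s)) \<partial>lborel) \<le> (\<integral>\<^sup>+ y. (\<Sum>k. ?g k y) \<partial>lborel)"
    proof (rule nn_integral_mono)
      fix y :: 'a
      show "ennreal (norm y powr (- s)) * indicator (ball 0 r) y \<le> (\<Sum>k. ?g k y)"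
        using powr_le_suminf_dyadic[OF r s(1), of y] by (cases "y \<in> ball 0 r") auto
    qed
    also have "\<dots> = (\<Sum>k. \<integral>\<^sup>+ y. ?g k y \<partial>lborel)"
      by (rule nn_integral_suminf)
      (intro borel_measurable_times_ennreal borel_measurable_const borel_measurable_indicator, simp)
    also have "\<dots> = (\<Sum>k. ennreal (2 powr s * ?V * r powr (?n - s) * \<rho> ^ k))"
    proof (intro suminf_cong)
      fix k
      let ?h = "(1/2::real) ^ k"
      have h: "?h > 0" by simp
      have "(\<integral>\<^sup>+ y. ?g k y \<partial>lborel) = ennreal ((r * (1/2) ^ Suc k) powr (- s) * (?V * (r * ?h) ^ DIM('a)))"
        using r by (subst nn_integral_cmult_indicator) (auto simp: emeasure_ball ennreal_mult)
      also have "(r * (1/2) ^ Suc k) powr (- s) * (?V * (r * ?h) ^ DIM('a))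
        = 2 powr s * ?V * r powr (?n - s) * \<rho> ^ k"
      proof -
        have 2: "?h powr (?n - s) = \<rho> ^ k"
          using powr_power_commute[of "1/2" k "?n - s"]
          by (simp add: \<rho>_def powr_divide powr_minus_divide[symmetric])
        have 3: "(r * (1/2) ^ Suc k) powr (- s) = 2 powr s * (r * ?h) powr (- s)"
        proof -
          have "r * (1/2) ^ Suc k = (1/2) * (r * ?h)" by simp
          also have "\<dots> powr (- s) = (1/2) powr (- s) * (r * ?h) powr (- s)"
            by (rule powr_mult)
          also have "(1/2::real) powr (- s) = 2 powr s"
            by (simp add: powr_divide powr_minus)
          finally show ?thesis .
        qed
        have 4: "(r * ?h) powr (- s) * (r * ?h) ^ DIM('a) = r powr (?n - s) * \<rho> ^ k"
          using powr_mult_power[of "r * ?h" "- s" "DIM('a)"] r powr_mult[of r ?h "?n - s"] 2 by simp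
        have "(r * (1/2) ^ Suc k) powr (- s) * (?V * (r * ?h) ^ DIM('a))
           = 2 powr s * ?V * ((r * ?h) powr (- s) * (r * ?h) ^ DIM('a))"
          unfolding 3 by simp
        then show ?thesis unfolding 4 by simp
      qed
      finally show "(\<integral>\<^sup>+ y. ?g k y \<partial>lborel) = ennreal (2 powr s * ?V * r powr (?n - s) * \<rho> ^ k)" .
    qed
    also have "\<dots> = ennreal (\<Sum>k. 2 powr s * ?V * r powr (?n - s) * \<rho> ^ k)"
      using \<rho> by (intro suminf_ennreal2) (auto intro!: summable_mult summable_geometric)
    also have "(\<Sum>k. 2 powr s * ?V * r powr (?n - s) * \<rho> ^ k) = C * r powr (?n - s)"
      using \<rho> by (subst suminf_mult) (auto simp: suminf_geometric C_def intro!: summable_geometric)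
    finally show ?thesis .
  qed
  moreover have "C \<ge> 0" using \<rho> by (auto simp: C_def)
  ultimately show ?thesis by blast
qed

text \<open>The same decomposition, now outwards: the least \<open>m\<close> with
  \<open>norm y < 2 * 2 ^ m\<close> also satisfies \<open>2 ^ m \<le> 1 + norm y\<close>. The series
  has ratio 2 to the power \<open>n - s\<close>, below 1 because \<open>s\<close> exceeds the
  dimension.\<close>

lemma nn_integral_shifted_norm_powr_finite:
  assumes s: "s > real DIM('a::euclidean_space)"
  shows "(\<integral>\<^sup>+ y. ennreal ((1 + norm (y::'a)) powr (- s)) \<partial>lborel) < \<infinity>"
proof -
  let ?n = "real DIM('a)"
  let ?V = "unit_ball_vol ?n"
  define \<rho> :: real where "\<rho> = 2 powr (?n - s)"
  have \<rho>: "0 < \<rho>" "\<rho> < 1"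
    using s powr_less_mono[of "?n - s" 0 2] by (auto simp: \<rho>_def)
  have s0: "s > 0" using s DIM_positive[where 'a='a] by linarith
  let ?g = "\<lambda>k y. ennreal ((2 ^ k) powr (- s)) * indicator (ball (0::'a) (2 * 2 ^ k)) y"
  have "(\<integral>\<^sup>+ y. ennreal ((1 + norm (y::'a)) powr (- s)) \<partial>lborel) \<le> (\<integral>\<^sup>+ y. (\<Sum>k. ?g k y) \<partial>lborel)"
  proof (rule nn_integral_mono)
    fix y :: 'a
    define P where "P k \<longleftrightarrow> norm y < 2 * 2 ^ k" for k :: nat
    obtain k0 where "norm y < 2 ^ k0" using real_arch_pow[of 2 "norm y"] by auto
    then have "P k0" unfolding P_def by (rule order_less_le_trans) simp
    define m where "m = (LEAST k. P k)"
    have m: "P m" unfolding m_def by (rule LeastI[of P, OF \<open>P k0\<close>])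
    have "2 ^ m \<le> 1 + norm y"
    \<comment> \<open>For \<open>m = 0\<close> there is no smaller index to compare with; the
      summand \<open>1\<close> in \<open>1 + norm y\<close> covers this case.\<close>
    proof (cases m)
      case (Suc k)
      have "\<not> P k" using not_less_Least[of k P] Suc by (simp add: m_def)
      then show ?thesis using Suc by (simp add: P_def)
    qed simp
    then have "(1 + norm y) powr (- s) \<le> (2 ^ m) powr (- s)"
      using s0 by (intro powr_mono2') auto
    then have "ennreal ((1 + norm y) powr (- s)) \<le> ?g m y"
      using m by (simp add: ennreal_leI P_def)
    also have "\<dots> \<le> (\<Sum>k. ?g k y)"
      by (rule le_suminf_ennreal[of "\<lambda>k. ?g k y"])
    finally show "ennreal ((1 + norm y) powr (- s)) \<le> (\<Sum>k. ?g k y)" .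
  qed
  also have "\<dots> = (\<Sum>k. \<integral>\<^sup>+ y. ?g k y \<partial>lborel)"
    by (rule nn_integral_suminf)
      (intro borel_measurable_times_ennreal borel_measurable_const borel_measurable_indicator, simp)
  also have "\<dots> = (\<Sum>k. ennreal (?V * 2 ^ DIM('a) * \<rho> ^ k))"
  proof (intro suminf_cong)
    fix k
    have "(2 ^ k) powr (- s) * (2 ^ k) ^ DIM('a) = ((2::real) ^ k) powr (?n - s)"
      using powr_mult_power[of "2 ^ k" "- s" "DIM('a)"] by simp
    also have "\<dots> = \<rho> ^ k"
      by (simp add: \<rho>_def powr_power_commute)
    finally have eq: "(2 ^ k) powr (- s) * (?V * (2 * 2 ^ k) ^ DIM('a)) = ?V * 2 ^ DIM('a) * \<rho> ^ k"
      by (simp add: power_mult_distrib)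
    have "(\<integral>\<^sup>+ y. ?g k y \<partial>lborel) = ennreal ((2 ^ k) powr (- s) * (?V * (2 * 2 ^ k) ^ DIM('a)))"
      by (subst nn_integral_cmult_indicator) (auto simp: emeasure_ball ennreal_mult)
    then show "(\<integral>\<^sup>+ y. ?g k y \<partial>lborel) = ennreal (?V * 2 ^ DIM('a) * \<rho> ^ k)"
      unfolding eq .
  qed
  also have "\<dots> = ennreal (\<Sum>k. ?V * 2 ^ DIM('a) * \<rho> ^ k)"
    using \<rho> by (intro suminf_ennreal2) (auto intro!: summable_mult summable_geometric)
  also have "\<dots> < \<infinity>" by simp
  finally show ?thesis .
qed

section \<open>Riesz potentials\<close>

text \<open>At \<open>y = x\<close> the integrand is \<open>0\<close> instead of infinite (division by zero), which affects a null set only.\<close>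

definition riesz_pot :: "real \<Rightarrow> ('a::euclidean_space \<Rightarrow> real) \<Rightarrow> 'a \<Rightarrow> ennreal" where
  "riesz_pot b f x = (\<integral>\<^sup>+ y. ennreal (f y / norm (x - y) powr b) \<partial>lborel)"

text \<open>The Jacobian contributes \<open>c ^ DIM('a)\<close> and the homogeneity of the kernel
  contributes \<open>c powr (- b)\<close>.\<close>

lemma riesz_pot_scale:
  fixes f :: "'a::euclidean_space \<Rightarrow> real"
  assumes [measurable]: "f \<in> borel_measurable borel" and c: "c > 0"
  shows "riesz_pot b f (c *\<^sub>R x)
    = ennreal (c powr (real DIM('a) - b)) * riesz_pot b (\<lambda>y. f (c *\<^sub>R y)) x"
proof -
  have "riesz_pot b f (c *\<^sub>R x) = ennreal (c ^ DIM('a)) *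
      (\<integral>\<^sup>+ y. ennreal (f (c *\<^sub>R y) / norm (c *\<^sub>R x - c *\<^sub>R y) powr b) \<partial>lborel)"
    unfolding riesz_pot_def using c by (subst nn_integral_lborel_scale[of _ c]) auto
  also have "(\<lambda>y. ennreal (f (c *\<^sub>R y) / norm (c *\<^sub>R x - c *\<^sub>R y) powr b))
    = (\<lambda>y. ennreal (c powr (- b)) * ennreal (f (c *\<^sub>R y) / norm (x - y) powr b))"
  proof
    fix y
    have "norm (c *\<^sub>R x - c *\<^sub>R y) = c * norm (x - y)"
      using c by (simp flip: scaleR_right_diff_distrib)
    then show "ennreal (f (c *\<^sub>R y) / norm (c *\<^sub>R x - c *\<^sub>R y) powr b)
       = ennreal (c powr (- b)) * ennreal (f (c *\<^sub>R y) / norm (x - y) powr b)"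
      by (simp add: powr_mult powr_minus field_simps flip: ennreal_mult')
  qed
  also have "(\<integral>\<^sup>+ y. ennreal (c powr (- b)) * ennreal (f (c *\<^sub>R y) / norm (x - y) powr b) \<partial>lborel)
    = ennreal (c powr (- b)) * riesz_pot b (\<lambda>y. f (c *\<^sub>R y)) x"
    unfolding riesz_pot_def by (intro nn_integral_cmult) auto
  also have "ennreal (c ^ DIM('a)) * (ennreal (c powr (- b)) * riesz_pot b (\<lambda>y. f (c *\<^sub>R y)) x)
    = ennreal (c ^ DIM('a) * c powr (- b)) * riesz_pot b (\<lambda>y. f (c *\<^sub>R y)) x"
    using c by (simp add: ennreal_mult mult.assoc)
  also have "c ^ DIM('a) * c powr (- b) = c powr (real DIM('a) - b)"
    using c by (simp add: powr_diff powr_minus powr_realpow field_simps)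
  finally show ?thesis .
qed

lemma riesz_pot_cmult:
  fixes f :: "'a::euclidean_space \<Rightarrow> real"
  assumes [measurable]: "f \<in> borel_measurable borel" and c: "c \<ge> 0"
  shows "riesz_pot b (\<lambda>y. c * f y) x = ennreal c * riesz_pot b f x"
  unfolding riesz_pot_def using c
  by (subst nn_integral_cmult[symmetric]) (auto simp flip: ennreal_mult' intro!: nn_integral_cong)

lemma riesz_pot_symmetric:
  fixes f g :: "'a::euclidean_space \<Rightarrow> real"
  assumes [measurable]: "f \<in> borel_measurable borel" "g \<in> borel_measurable borel"
    and "\<And>x. f x \<ge> 0" "\<And>x. g x \<ge> 0"
  shows "(\<integral>\<^sup>+ x. ennreal (g x) * riesz_pot b f x \<partial>lborel)
    = (\<integral>\<^sup>+ x. ennreal (f x) * riesz_pot b g x \<partial>lborel)"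
proof -
  have "(\<integral>\<^sup>+ x. ennreal (g x) * riesz_pot b f x \<partial>lborel)
    = (\<integral>\<^sup>+ x. \<integral>\<^sup>+ y. ennreal (g x) * ennreal (f y / norm (x - y) powr b) \<partial>lborel \<partial>lborel)"
    unfolding riesz_pot_def by (intro nn_integral_cong nn_integral_cmult[symmetric]) auto
  also have "\<dots> = (\<integral>\<^sup>+ y. \<integral>\<^sup>+ x. ennreal (g x) * ennreal (f y / norm (x - y) powr b) \<partial>lborel \<partial>lborel)"
    by (rule lborel_pair.Fubini'[symmetric]) auto
  also have "\<dots> = (\<integral>\<^sup>+ y. \<integral>\<^sup>+ x. ennreal (f y) * ennreal (g x / norm (y - x) powr b) \<partial>lborel \<partial>lborel)"
    using assms by (intro nn_integral_cong)
      (auto simp: norm_minus_commute mult.commute simp flip: ennreal_mult')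
  also have "\<dots> = (\<integral>\<^sup>+ y. ennreal (f y) * riesz_pot b g y \<partial>lborel)"
    unfolding riesz_pot_def by (intro nn_integral_cong nn_integral_cmult) auto
  finally show ?thesis .
qed

section \<open>Difference estimates and lower bounds for potentials\<close>

text \<open>By the mean value theorem the difference is governed by an intermediate power with
  exponent \<open>- (b + 1)\<close>, which is at most the one at the smaller endpoint. Taking the
  sum over both endpoints makes the bound symmetric, so that it integrates to two potentials of
  order \<open>b + 1\<close>.\<close>

lemma powr_minus_diff_le:
  fixes s t b :: real
  assumes "s > 0" "t > 0" "b > 0"
  shows "s powr (- b) \<le> t powr (- b) + b * \<bar>s - t\<bar> * (s powr (- (b + 1)) + t powr (- (b + 1)))"
proof (cases "s < t")
  case True
  have "\<exists>z. s < z \<and> z < t \<and> t powr (- b) - s powr (- b) = (t - s) * ((- b) * z powr (- b - 1))"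
    using True assms by (intro MVT2) (auto intro!: derivative_eq_intros)
  then obtain z where z: "s < z" "z < t"
    and eq: "t powr (- b) - s powr (- b) = (t - s) * ((- b) * z powr (- b - 1))" by blast
  have "s powr (- b) - t powr (- b) = b * (t - s) * z powr (- (b + 1))"
  proof -
    have "- b - 1 = - (b + 1)" by simp
    with eq show ?thesis by (simp only:) (simp add: algebra_simps)
  qed
  also have "\<dots> \<le> b * (t - s) * (s powr (- (b + 1)) + t powr (- (b + 1)))"
    using z assms True powr_mono2'[of "- (b + 1)" s z] 
    by (intro mult_left_mono) (auto intro: add_increasing2)
  finally show ?thesis using True by simp
next
  case False
  then have "s powr (- b) \<le> t powr (- b)" using assms by (intro powr_mono2') auto
  then show ?thesis using assms by (smt (verit) mult_nonneg_nonneg powr_ge_zero)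
qed

text \<open>The pointwise kernel estimate is integrated, using that the distances from
  \<open>y\<close> to \<open>z\<close> and to \<open>x\<close> differ by at most
  \<open>norm (z - x)\<close>. The points \<open>x\<close> and \<open>z\<close>, where a distance
  vanishes, form a null set.\<close>

lemma riesz_pot_diff:
  fixes f :: "'a::euclidean_space \<Rightarrow> real"
  assumes [measurable]: "f \<in> borel_measurable borel" and f: "\<And>x. f x \<ge> 0" and b: "b > 0"
  shows "riesz_pot b f z \<le> riesz_pot b f x
    + ennreal (b * norm (z - x)) * (riesz_pot (b + 1) f z + riesz_pot (b + 1) f x)"
proof -
  let ?K = "\<lambda>c x y. f y / norm (x - y) powr c"
  have "riesz_pot b f z \<le> (\<integral>\<^sup>+ y. ennreal (?K b x y) + ennreal (b * norm (z - x)) *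
      (ennreal (?K (b + 1) z y) + ennreal (?K (b + 1) x y)) \<partial>lborel)"
    unfolding riesz_pot_def
  proof (rule nn_integral_mono_AE)
    show "AE y in lborel. ennreal (?K b z y) \<le> ennreal (?K b x y) + ennreal (b * norm (z - x)) *
      (ennreal (?K (b + 1) z y) + ennreal (?K (b + 1) x y))"
      using AE_lborel_singleton[of x] AE_lborel_singleton[of z]
    proof eventually_elim
      case (elim y)
      let ?s = "norm (z - y)" and ?t = "norm (x - y)"
      have pos: "?s > 0" "?t > 0" using elim by auto
      have "\<bar>?s - ?t\<bar> \<le> norm (z - x)"
        using norm_triangle_ineq3[of "z - y" "x - y"] by simp
      then have "?s powr (- b) \<le> ?t powr (- b) + b * norm (z - x) * (?s powr (- (b + 1)) + ?t powr (- (b + 1)))"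
        using powr_minus_diff_le[OF pos b] b
        by (smt (verit, best) mult_left_mono mult_right_mono powr_ge_zero)
      from mult_left_mono[OF this f[of y]]
      have "?K b z y \<le> ?K b x y + (b * norm (z - x)) * (?K (b + 1) z y + ?K (b + 1) x y)"
        unfolding powr_minus by (simp add: field_simps)
      then show ?case
        using f b by (simp flip: ennreal_plus ennreal_mult add: ennreal_leI)
    qed
  qed
  also have "\<dots> = riesz_pot b f x
    + ennreal (b * norm (z - x)) * (riesz_pot (b + 1) f z + riesz_pot (b + 1) f x)"
    unfolding riesz_pot_def by (simp add: nn_integral_add nn_integral_cmult)
  finally show ?thesis .
qed

text \<open>Away from \<open>x\<close>, where \<open>norm x \<le> 2 * norm (x - y)\<close>, one
  power of the kernel is traded for the factor \<open>norm x\<close>; this gives the term with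
  \<open>2\<close>. Near \<open>x\<close> the density is at most \<open>M\<close>, and the kernel of
  order \<open>b + 1\<close> is locally integrable because \<open>b + 1\<close> is below the
  dimension. The constant depends only on \<open>b\<close> and the dimension.\<close>

lemma riesz_pot_add_one_bound:
  assumes b: "b > 0" "b + 1 < real DIM('a::euclidean_space)"
  shows "\<exists>C\<ge>0. \<forall>(f::'a \<Rightarrow> real) x M. f \<in> borel_measurable borel \<longrightarrow> (\<forall>y. f y \<ge> 0) \<longrightarrow> x \<noteq> 0 \<longrightarrow> M \<ge> 0 \<longrightarrow>
     (\<forall>y. norm (x - y) < norm x / 2 \<longrightarrow> f y \<le> M) \<longrightarrow>
     ennreal (norm x) * riesz_pot (b + 1) f x
        \<le> 2 * riesz_pot b f x + ennreal (C * M * norm x powr (real DIM('a) - b))"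
proof -
  let ?n = "real DIM('a)"
  obtain C0 where C0: "C0 \<ge> 0" and bd: "\<And>r. r > 0 \<Longrightarrow>
      (\<integral>\<^sup>+ y\<in>ball (0::'a) r. ennreal (norm y powr (- (b + 1))) \<partial>lborel) \<le> ennreal (C0 * r powr (?n - (b + 1)))"
    using nn_integral_ball_powr_le[of "b + 1", where 'a='a] b by auto
  have main: "ennreal (norm x) * riesz_pot (b + 1) f x
        \<le> 2 * riesz_pot b f x + ennreal (C0 * M * norm x powr (?n - b))"
    if fm[measurable]: "f \<in> borel_measurable borel" and f: "\<And>y. f y \<ge> 0" and x: "x \<noteq> 0" and M: "M \<ge> 0"
      and fM: "\<And>y. norm (x - y) < norm x / 2 \<Longrightarrow> f y \<le> M" for f :: "'a \<Rightarrow> real" and x M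
  proof -
    let ?r = "norm x"
    define g where "g z = ennreal (norm z powr (- (b + 1))) * indicator (ball 0 (?r / 2)) z" for z :: 'a
    have [measurable]: "g \<in> borel_measurable borel"
      unfolding g_def by (intro borel_measurable_times_ennreal borel_measurable_indicator) auto
    have r: "?r > 0" using x by simp
    have "ennreal ?r * riesz_pot (b + 1) f x
      = (\<integral>\<^sup>+ y. ennreal ?r * ennreal (f y / norm (x - y) powr (b + 1)) \<partial>lborel)"
      unfolding riesz_pot_def by (intro nn_integral_cmult[symmetric]) auto
    also have "\<dots> \<le> (\<integral>\<^sup>+ y. 2 * ennreal (f y / norm (x - y) powr b)
        + ennreal (?r * M) * g (x - y) \<partial>lborel)"
    proof (rule nn_integral_mono)
      fix y
      show "ennreal ?r * ennreal (f y / norm (x - y) powr (b + 1))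
        \<le> 2 * ennreal (f y / norm (x - y) powr b) + ennreal (?r * M) * g (x - y)"
      proof (cases "norm (x - y) < ?r / 2")
        case True
        have "?r * (f y / norm (x - y) powr (b + 1)) \<le> ?r * (M / norm (x - y) powr (b + 1))"
          using fM[OF True] r by (intro mult_left_mono divide_right_mono) auto
        also have "\<dots> = (?r * M) * norm (x - y) powr (- (b + 1))"
          unfolding powr_minus by (simp add: field_simps)
        finally have "ennreal ?r * ennreal (f y / norm (x - y) powr (b + 1)) \<le> ennreal (?r * M) * g (x - y)"
          using True M r by (simp add: g_def ennreal_leI flip: ennreal_mult')
        then show ?thesis by (simp add: add_increasing)
      next
        case False
        then have d: "norm (x - y) > 0" "?r \<le> 2 * norm (x - y)" using r by (auto simp del: zero_less_norm_iff)
        have "?r * (f y / norm (x - y) powr (b + 1)) \<le> (2 * norm (x - y)) * (f y / norm (x - y) powr (b + 1))"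
          using d f by (intro mult_right_mono) auto
        also have "\<dots> = 2 * (f y / norm (x - y) powr b)"
          using d by (simp add: powr_add)
        finally have "ennreal (?r * (f y / norm (x - y) powr (b + 1))) \<le> ennreal (2 * (f y / norm (x - y) powr b))"
          by (rule ennreal_leI)
        then have "ennreal ?r * ennreal (f y / norm (x - y) powr (b + 1)) \<le> 2 * ennreal (f y / norm (x - y) powr b)"
          using ennreal_mult'[of 2 "f y / norm (x - y) powr b"]
            ennreal_mult'[of ?r "f y / norm (x - y) powr (b + 1)"] by simp
        then show ?thesis by (simp add: add_increasing2)
      qed
    qed
    also have "\<dots> = 2 * riesz_pot b f x + ennreal (?r * M) * (\<integral>\<^sup>+ y. g (x - y) \<partial>lborel)"
      unfolding riesz_pot_def by (simp add: nn_integral_add nn_integral_cmult)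
    also have "(\<integral>\<^sup>+ y. g (x - y) \<partial>lborel) = (\<integral>\<^sup>+ z. g z \<partial>lborel)"
      by (rule nn_integral_lborel_reflect[symmetric]) simp

    also have "\<dots> \<le> ennreal (C0 * (?r / 2) powr (?n - (b + 1)))"
      using bd[of "?r / 2"] r by (simp add: g_def)
    also have "\<dots> \<le> ennreal (C0 * ?r powr (?n - (b + 1)))"
      using C0 r b by (intro ennreal_leI mult_left_mono powr_mono2) auto
    also have "ennreal (?r * M) * ennreal (C0 * ?r powr (?n - (b + 1))) = ennreal (C0 * M * ?r powr (?n - b))"
    proof -
      have "?r * ?r powr (?n - (b + 1)) = ?r powr (?n - b)"
        using r powr_add[of ?r 1 "?n - (b + 1)"] by simp
      then have "(?r * M) * (C0 * ?r powr (?n - (b + 1))) = C0 * M * ?r powr (?n - b)"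
        by (metis (no_types, lifting) mult.assoc mult.commute)
      then show ?thesis using C0 M r by (simp flip: ennreal_mult)
    qed
    finally show ?thesis by (simp add: add_left_mono mult_left_mono)
  qed
  show ?thesis using C0 main by blast
qed

text \<open>Only the ball of radius \<open>r\<close> about \<open>x\<close> is kept, where the
  kernel is at least \<open>r powr (- b)\<close>.\<close>

lemma riesz_pot_lower:
  fixes f :: "'a::euclidean_space \<Rightarrow> real"
  assumes r: "r > 0" and b: "b \<ge> 0" and m: "m \<ge> 0"
    and f: "\<And>y. norm (x - y) < r \<Longrightarrow> f y \<ge> m"
  shows "ennreal (unit_ball_vol DIM('a) * m * r powr (real DIM('a) - b)) \<le> riesz_pot b f x"
proof -
  have "ennreal (unit_ball_vol DIM('a) * m * r powr (real DIM('a) - b))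
     = ennreal (m * r powr (- b)) * emeasure lborel (ball x r)"
    using r m by (simp add: emeasure_ball powr_diff powr_minus powr_realpow field_simps flip: ennreal_mult)
  \<comment> \<open>The centre is removed because the integrand of \<open>riesz_pot\<close> takes
    the default value \<open>0\<close> there, so the pointwise bound could fail at that
    point.\<close>
  also have "\<dots> = (\<integral>\<^sup>+ y. ennreal (m * r powr (- b)) * indicator (ball x r - {x}) y \<partial>lborel)"
    by (subst nn_integral_cmult_indicator) (auto simp: emeasure_Diff_null_set null_sets_def)
  also have "\<dots> \<le> riesz_pot b f x"
    unfolding riesz_pot_def
  proof (rule nn_integral_mono)
    fix y
    show "ennreal (m * r powr (- b)) * indicator (ball x r - {x}) y \<le> ennreal (f y / norm (x - y) powr b)"
    proof (cases "y \<in> ball x r - {x}")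
      case True
      then have d: "0 < norm (x - y)" "norm (x - y) < r" by (auto simp: dist_norm)
      have "m * r powr (- b) \<le> f y * norm (x - y) powr (- b)"
        using d b m f[OF d(2)] by (intro mult_mono powr_mono2') auto
      also have "\<dots> = f y / norm (x - y) powr b" by (simp add: powr_minus field_simps)
      finally show ?thesis using True by (simp add: ennreal_leI)
    qed auto
  qed
  finally show ?thesis .
qed

section \<open>Decaying solutions\<close>

text \<open>The asymptotic bounds become global: on a compact ball, continuity and positivity give a
  positive minimum and a finite maximum, and outside it \<open>norm x\<close> and
  \<open>1 + norm x\<close> are comparable.\<close>

lemma decays_like_bounds:
  fixes u :: "'a::euclidean_space \<Rightarrow> real"
  assumes dec: "decays_like u \<theta>" and \<theta>: "\<theta> > 0"
    and cont: "continuous_on UNIV u" and pos: "\<And>x. u x > 0"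
  obtains c C where "c > 0" "C > 0"
    "\<And>x. c * (1 + norm x) powr (- \<theta>) \<le> u x" "\<And>x. u x \<le> C * (1 + norm x) powr (- \<theta>)"
proof -
  obtain c0 C0 R where c0: "c0 > 0" "C0 > 0"
    and bd: "\<And>x. norm x \<ge> R \<Longrightarrow> c0 * norm x powr (- \<theta>) \<le> u x \<and> u x \<le> C0 * norm x powr (- \<theta>)"
    using dec unfolding decays_like_def by blast
  \<comment> \<open>Radius at least 1 makes the ball nonempty and gives
    \<open>1 + norm x \<le> 2 * norm x\<close> outside it.\<close>
  define R' where "R' = max R 1"
  have ne: "cball (0::'a) R' \<noteq> {}" by (auto simp: R'_def)
  have c': "continuous_on (cball 0 R') u" using cont continuous_on_subset by blast
  obtain a where a: "\<And>x. x \<in> cball 0 R' \<Longrightarrow> u a \<le> u x"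
    using continuous_attains_inf[OF compact_cball ne c'] by blast
  obtain d where d: "\<And>x. x \<in> cball 0 R' \<Longrightarrow> u x \<le> u d"
    using continuous_attains_sup[OF compact_cball ne c'] by blast
  \<comment> \<open>Here \<open>u a\<close> and \<open>u d\<close> are the extreme values on the
    ball. The factor \<open>(1 + R') powr \<theta>\<close> offsets the decay inside the ball, and
    \<open>2 powr \<theta>\<close> pays for passing from \<open>norm x\<close> to
    \<open>1 + norm x\<close> outside.\<close>
  define c where "c = min (u a) c0"
  define C where "C = max (u d * (1 + R') powr \<theta>) (C0 * 2 powr \<theta>)"
  show thesis
  proof (rule that[of c C])
    show "c > 0" using c0 pos by (simp add: c_def)
    show "C > 0" using c0 by (simp add: C_def less_max_iff_disj)
    show "c * (1 + norm x) powr (- \<theta>) \<le> u x" for x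
    proof (cases "norm x \<le> R'")
      case True
      have "(1 + norm x) powr (- \<theta>) \<le> 1 powr (- \<theta>)" using \<theta> by (intro powr_mono2') auto
      then have "c * (1 + norm x) powr (- \<theta>) \<le> u a * 1"
        using c0 pos[of a] by (intro mult_mono) (auto simp: c_def)
      then show ?thesis using a[of x] True by simp
    next
      case False
      then have x: "norm x \<ge> R" "norm x > 0" by (auto simp: R'_def simp del: zero_less_norm_iff)
      have "(1 + norm x) powr (- \<theta>) \<le> norm x powr (- \<theta>)" using \<theta> x by (intro powr_mono2') auto
      then have "c * (1 + norm x) powr (- \<theta>) \<le> c0 * norm x powr (- \<theta>)"
        using c0 by (intro mult_mono) (auto simp: c_def)
      then show ?thesis using bd[OF x(1)] by simp
    qed
    show "u x \<le> C * (1 + norm x) powr (- \<theta>)" for x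
    proof (cases "norm x \<le> R'")
      case True
      have "u x \<le> u d" using d True by simp
      also have "\<dots> = u d * (1 + R') powr \<theta> * (1 + R') powr (- \<theta>)"
        by (simp add: R'_def powr_minus field_simps)
      also have "\<dots> \<le> C * (1 + norm x) powr (- \<theta>)"
        using \<theta> True pos[of d] by (intro mult_mono powr_mono2') (use c0 in \<open>auto simp: C_def add_pos_nonneg le_max_iff_disj\<close>)
      finally show ?thesis .
    next
      case False
      then have x: "norm x \<ge> R" "norm x \<ge> 1" by (auto simp: R'_def)
      have "u x \<le> C0 * norm x powr (- \<theta>)" using bd x by blast
      also have "\<dots> \<le> C0 * ((1 + norm x) / 2) powr (- \<theta>)"
        using c0 \<theta> x by (intro mult_left_mono powr_mono2') auto
      also have "\<dots> = C0 * 2 powr \<theta> * (1 + norm x) powr (- \<theta>)"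
        by (simp add: powr_divide powr_minus field_simps)
      also have "\<dots> \<le> C * (1 + norm x) powr (- \<theta>)"
        by (intro mult_right_mono) (auto simp: C_def)
      finally show ?thesis .
    qed
  qed
qed

text \<open>At distance \<open>t\<close> from the origin, the ball of radius \<open>t / 2\<close>
  alone contributes a multiple of \<open>t powr (real DIM('a) - b - q * \<theta> - \<sigma>)\<close>
  to the potential. Compared with the upper bound of order \<open>t powr (- \<eta>)\<close> for
  large \<open>t\<close>, this forces the exponent inequality.\<close>

lemma riesz_pot_decay_exponent:
  fixes u w :: "'a::euclidean_space \<Rightarrow> real"
  assumes par: "q > 0" "\<theta> > 0" "\<eta> > 0" "\<sigma> \<ge> 0" "b \<ge> 0"
    and c: "c > 0" "\<And>x. c * (1 + norm x) powr (- \<theta>) \<le> w x"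
    and C: "C > 0" "\<And>x. u x \<le> C * (1 + norm x) powr (- \<eta>)"
    and eq: "\<And>x. ennreal (u x) = riesz_pot b (\<lambda>y. w y powr q / norm y powr \<sigma>) x"
  shows "\<eta> \<le> q * \<theta> + \<sigma> - (real DIM('a) - b)"
proof (rule ccontr)
  let ?n = "real DIM('a)"
  let ?V = "unit_ball_vol ?n"
  define \<epsilon> where "\<epsilon> = \<eta> - (q * \<theta> + \<sigma> - (?n - b))"
  assume "\<not> \<eta> \<le> q * \<theta> + \<sigma> - (?n - b)"
  then have \<epsilon>: "\<epsilon> > 0" by (simp add: \<epsilon>_def)
  \<comment> \<open>On the ball of radius \<open>t / 2\<close> about a point of norm
    \<open>t \<ge> 1\<close> one has \<open>norm y \<le> 3/2 * t\<close> and
    \<open>1 + norm y \<le> 5/2 * t\<close>. \<open>K'\<close> adds the ball volume and the halved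
    radius.\<close>
  define K where "K = c powr q * (5/2) powr (- (\<theta> * q)) * (3/2) powr (- \<sigma>)"
  define K' where "K' = ?V * K * (1/2) powr (?n - b)"
  have K: "K > 0" "K' > 0" using c by (auto simp: K_def K'_def)
  have key: "t powr \<epsilon> \<le> C / K'" if t: "t \<ge> 1" for t
  proof -
    obtain e :: 'a where e: "norm e = 1" using vector_choose_size[of 1] by auto
    define x where "x = t *\<^sub>R e"
    have x: "norm x = t" using t e by (simp add: x_def)
    define m where "m = K * t powr (- (\<theta> * q + \<sigma>))"
    have m: "m \<ge> 0" using K by (simp add: m_def)
    have fm: "m \<le> w y powr q / norm y powr \<sigma>" if y: "norm (x - y) < t / 2" for y
    proof -
      have y1: "norm y \<le> 3/2 * t" "1 + norm y \<le> 5/2 * t" "norm y > 0"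
        using norm_triangle_ineq2[of x y] norm_triangle_ineq2[of y x] y x t
        by (auto simp: norm_minus_commute simp del: zero_less_norm_iff)
      have "c * (5/2 * t) powr (- \<theta>) \<le> c * (1 + norm y) powr (- \<theta>)"
        using c par y1 by (intro mult_left_mono powr_mono2') (auto intro: add_pos_nonneg)
      also have "\<dots> \<le> w y" by (rule c)
      finally have "(c * (5/2 * t) powr (- \<theta>)) powr q \<le> w y powr q"
        using par c by (intro powr_mono2) auto
      moreover have "(3/2 * t) powr (- \<sigma>) \<le> norm y powr (- \<sigma>)"
        using par y1 by (intro powr_mono2') auto
      ultimately have "(c * (5/2 * t) powr (- \<theta>)) powr q * (3/2 * t) powr (- \<sigma>)
          \<le> w y powr q * norm y powr (- \<sigma>)"
        by (intro mult_mono) auto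
      moreover have "(c * (5/2 * t) powr (- \<theta>)) powr q * (3/2 * t) powr (- \<sigma>) = m"
      proof -
        have "(c * (5/2 * t) powr (- \<theta>)) powr q = c powr q * ((5/2) powr (- (\<theta> * q)) * t powr (- (\<theta> * q)))"
          by (simp only: powr_mult powr_powr) simp
        moreover have "(3/2 * t) powr (- \<sigma>) = (3/2) powr (- \<sigma>) * t powr (- \<sigma>)"
          by (rule powr_mult)
        moreover have "t powr (- (\<theta> * q + \<sigma>)) = t powr (- (\<theta> * q)) * t powr (- \<sigma>)"
          by (simp add: powr_add[symmetric])
        ultimately show ?thesis by (simp add: m_def K_def)
      qed
      ultimately show ?thesis by (simp add: powr_minus field_simps)
    qed
    have "ennreal (?V * m * (t / 2) powr (?n - b)) \<le> ennreal (u x)"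
      unfolding eq using par t m fm by (intro riesz_pot_lower) auto
    moreover have "?V * m * (t / 2) powr (?n - b) > 0" using K t by (simp add: m_def)
    ultimately have "?V * m * (t / 2) powr (?n - b) \<le> u x"
      by (metis ennreal_le_iff2 less_le_not_le linorder_le_cases)
    also have "\<dots> \<le> C * (1 + t) powr (- \<eta>)" using C(2)[of x] x by simp
    also have "\<dots> \<le> C * t powr (- \<eta>)"
      using C(1) par t by (intro mult_left_mono powr_mono2') auto
    finally have 1: "?V * m * (t / 2) powr (?n - b) \<le> C * t powr (- \<eta>)" .
    have "?V * m * (t / 2) powr (?n - b) = K' * (t powr (- (\<theta> * q + \<sigma>)) * t powr (?n - b))"
      using powr_mult[of "1/2" t "?n - b"] by (simp add: m_def K'_def)
    also have "t powr (- (\<theta> * q + \<sigma>)) * t powr (?n - b) = t powr (\<epsilon> + - \<eta>)"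
      by (subst powr_add[symmetric]) (simp add: \<epsilon>_def algebra_simps)
    also have "\<dots> = t powr \<epsilon> * t powr (- \<eta>)" by (rule powr_add)
    finally have "K' * t powr \<epsilon> * t powr (- \<eta>) \<le> C * t powr (- \<eta>)" using 1 by simp
    then have "K' * t powr \<epsilon> \<le> C" using t by simp
    then show ?thesis using K by (simp add: field_simps)
  qed
  \<comment> \<open>Chosen so that \<open>t powr \<epsilon>\<close> exceeds the bound
    \<open>C / K'\<close> by exactly 1.\<close>
  define t where "t = (C / K' + 1) powr (1 / \<epsilon>)"
  have "C / K' + 1 \<ge> 1" using C K by simp
  then have "t \<ge> 1" using \<epsilon> by (simp add: t_def ge_one_powr_ge_zero)
  moreover have "t powr \<epsilon> = C / K' + 1" using \<epsilon> C K by (simp add: t_def powr_powr add_pos_pos)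
  ultimately show False using key[of t] by simp
qed

text \<open>The step from \<open>x\<close> to \<open>l *\<^sub>R x\<close> has length
  \<open>(1 - l) * norm x\<close>. By \<open>riesz_pot_diff\<close> the change of \<open>u\<close>
  is at most this length times potentials of order \<open>b + 1\<close>, and the factor
  \<open>norm x\<close> turns these back into multiples of \<open>u x\<close> by
  \<open>riesz_pot_add_one_bound\<close>.\<close>

lemma riesz_pot_dilation_lipschitz:
  fixes u w :: "'a::euclidean_space \<Rightarrow> real"
  assumes par: "q > 0" "\<theta> > 0" "\<eta> > 0" "\<sigma> \<ge> 0" "\<sigma> \<le> real DIM('a) - b" "b > 0" "b + 1 < real DIM('a)"
    and [measurable]: "w \<in> borel_measurable borel" and w: "\<And>x. w x > 0" and u: "\<And>x. u x > 0"
    and D: "D > 0" "\<And>x. w x \<le> D * (1 + norm x) powr (- \<theta>)"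
    and c: "c > 0" "\<And>x. c * (1 + norm x) powr (- \<eta>) \<le> u x"
    and C: "C > 0" "\<And>x. u x \<le> C * (1 + norm x) powr (- \<eta>)"
    and eq: "\<And>x. ennreal (u x) = riesz_pot b (\<lambda>y. w y powr q / norm y powr \<sigma>) x"
    and ex: "\<eta> \<le> q * \<theta> + \<sigma> - (real DIM('a) - b)"
  shows "\<exists>L\<ge>0. \<forall>x l. 1/2 \<le> l \<longrightarrow> l \<le> 1 \<longrightarrow> \<bar>u (l *\<^sub>R x) - u x\<bar> \<le> L * (1 - l) * u x"
proof -
  let ?n = "real DIM('a)"
  let ?f = "\<lambda>y. w y powr q / norm y powr \<sigma>"
  have f0: "?f y \<ge> 0" for y by simp
  obtain B where B: "B \<ge> 0" and bd: "\<And>(f::'a \<Rightarrow> real) x M. f \<in> borel_measurable borel \<Longrightarrow>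
     (\<And>y. f y \<ge> 0) \<Longrightarrow> x \<noteq> 0 \<Longrightarrow> M \<ge> 0 \<Longrightarrow>
     (\<And>y. norm (x - y) < norm x / 2 \<Longrightarrow> f y \<le> M) \<Longrightarrow>
     ennreal (norm x) * riesz_pot (b + 1) f x
        \<le> 2 * riesz_pot b f x + ennreal (B * M * norm x powr (?n - b))"
    using riesz_pot_add_one_bound[of b, where 'a='a] par by blast
  define K where "K = D powr q * (1/2) powr (- (\<theta> * q)) * (1/2) powr (- \<sigma>)"
  have K: "K > 0" using D by (simp add: K_def)
  \<comment> \<open>The \<open>2\<close> is the far contribution; \<open>B * K / c\<close> is the
    near one, measured in units of \<open>u x\<close> through its lower bound.\<close>
  define G where "G = 2 + B * K / c"
  have G: "G \<ge> 0" using B K c by (simp add: G_def)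
  \<comment> \<open>\<open>enn2real\<close> sends infinity to \<open>0\<close>, so \<open>N\<close>
    is meaningful only where finiteness is shown, that is for \<open>x \<noteq> 0\<close>.\<close>
  define N where "N x = enn2real (riesz_pot (b + 1) ?f x)" for x
  have N: "riesz_pot (b + 1) ?f x = ennreal (N x) \<and> norm x * N x \<le> G * u x" if x: "x \<noteq> 0" for x
  proof -
    define M where "M = K * (1 + norm x) powr (- (\<theta> * q)) * norm x powr (- \<sigma>)"
    have M: "M \<ge> 0" using K by (simp add: M_def)
    have fM: "?f y \<le> M" if y: "norm (x - y) < norm x / 2" for y
    proof -
      have "norm x > 0" using x by simp
      moreover have y0: "norm y \<ge> 1/2 * norm x"
        using norm_triangle_ineq2[of x y] y by linarith
      ultimately have "norm y > 0" by linarith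
      then have y1: "norm y \<ge> 1/2 * norm x" "1 + norm y \<ge> 1/2 * (1 + norm x)" "norm y > 0"
        using y0 by (auto simp del: zero_less_norm_iff)
      have "w y \<le> D * (1 + norm y) powr (- \<theta>)" by (rule D)
      also have "\<dots> \<le> D * (1/2 * (1 + norm x)) powr (- \<theta>)"
        using D par y1 by (intro mult_left_mono powr_mono2') (auto intro: add_pos_nonneg)
      finally have "w y powr q \<le> (D * (1/2 * (1 + norm x)) powr (- \<theta>)) powr q"
        using par w[of y] by (intro powr_mono2) auto
      moreover have "norm y powr (- \<sigma>) \<le> (1/2 * norm x) powr (- \<sigma>)"
        using par y1 x by (intro powr_mono2') auto
      ultimately have "w y powr q * norm y powr (- \<sigma>)
          \<le> (D * (1/2 * (1 + norm x)) powr (- \<theta>)) powr q * (1/2 * norm x) powr (- \<sigma>)"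
        by (intro mult_mono) auto
      also have "\<dots> = M"
      proof -
        have "(D * (1/2 * (1 + norm x)) powr (- \<theta>)) powr q
          = D powr q * ((1/2) powr (- (\<theta> * q)) * (1 + norm x) powr (- (\<theta> * q)))"
          by (simp only: powr_mult powr_powr) simp
        moreover have "(1/2 * norm x) powr (- \<sigma>) = (1/2) powr (- \<sigma>) * norm x powr (- \<sigma>)"
          by (rule powr_mult)
        ultimately show ?thesis by (simp add: M_def K_def)
      qed
      finally show ?thesis by (simp add: powr_minus field_simps)
    qed
    \<comment> \<open>The singular weight is absorbed into \<open>norm x powr (?n - b)\<close>; as
      \<open>\<sigma> \<le> ?n - b\<close>, the remaining power is nonnegative and the base can be
      raised to \<open>1 + norm x\<close>. Then \<open>ex\<close> bounds the total exponent by
      \<open>- \<eta>\<close>, the decay rate of \<open>u\<close>.\<close>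
    have "M * norm x powr (?n - b) = K * ((1 + norm x) powr (- (\<theta> * q)) * norm x powr (?n - b - \<sigma>))"
      using powr_add[of "norm x" "- \<sigma>" "?n - b"] by (simp add: M_def)
    also have "\<dots> \<le> K * ((1 + norm x) powr (- (\<theta> * q)) * (1 + norm x) powr (?n - b - \<sigma>))"
      using K par by (intro mult_left_mono powr_mono2) auto
    also have "\<dots> = K * (1 + norm x) powr (- (\<theta> * q) + (?n - b - \<sigma>))"
      by (simp only: powr_add)
    also have "\<dots> \<le> K * (1 + norm x) powr (- \<eta>)"
      using K ex by (intro mult_left_mono powr_mono) (auto simp: mult.commute)
    also have "\<dots> \<le> K / c * u x"
      using mult_left_mono[OF c(2)[of x], of "K / c"] K c(1) by simp
    finally have "B * (M * norm x powr (?n - b)) \<le> B * (K / c * u x)"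
      using B by (intro mult_left_mono)
    then have *: "2 * u x + B * M * norm x powr (?n - b) \<le> G * u x"
      by (simp add: G_def algebra_simps)
    have "ennreal (norm x) * riesz_pot (b + 1) ?f x
        \<le> 2 * riesz_pot b ?f x + ennreal (B * M * norm x powr (?n - b))"
      using x M fM by (intro bd) auto
    also have "\<dots> = ennreal (2 * u x + B * M * norm x powr (?n - b))"
      using u[of x] B M by (simp add: eq[symmetric] ennreal_plus ennreal_mult')
    also have "\<dots> \<le> ennreal (G * u x)" by (intro ennreal_leI *)
    finally have le: "ennreal (norm x) * riesz_pot (b + 1) ?f x \<le> ennreal (G * u x)" .
    have fin: "riesz_pot (b + 1) ?f x = ennreal (N x)"
    proof -
      have "riesz_pot (b + 1) ?f x \<noteq> top"
        using le x by (auto simp: ennreal_mult_top top_unique)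
      then show ?thesis by (simp add: N_def ennreal_enn2real_if)
    qed
    moreover have "N x \<ge> 0" by (simp add: N_def)
    moreover have "norm x * N x \<le> G * u x"
      using le unfolding fin using G u[of x] by (simp flip: ennreal_mult')
    ultimately show ?thesis by blast
  qed
  have N0: "N x \<ge> 0" for x by (simp add: N_def)
  have diff: "u z \<le> u x + b * norm (z - x) * (N z + N x)" if "z \<noteq> 0" "x \<noteq> 0" for z x
  proof -
    have "ennreal (u z) \<le> ennreal (u x) + ennreal (b * norm (z - x)) * (ennreal (N z) + ennreal (N x))"
      using riesz_pot_diff[of ?f b z x] par N that by (simp add: eq)
    also have "\<dots> = ennreal (u x + b * norm (z - x) * (N z + N x))"
      using u[of x] par N0[of x] N0[of z] by (simp add: ennreal_plus ennreal_mult)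
    finally have "ennreal (u z) \<le> ennreal (u x + b * norm (z - x) * (N z + N x))" .
    moreover have "0 \<le> u x + b * norm (z - x) * (N z + N x)"
      using u[of x] par N0[of x] N0[of z] by simp
    ultimately show ?thesis by (metis ennreal_le_iff)
  qed
  \<comment> \<open>For \<open>l \<ge> 1/2\<close> one has
    \<open>1 + norm (l *\<^sub>R x) \<ge> 1/2 * (1 + norm x)\<close>, whence a Harnack-type bound
    \<open>u (l *\<^sub>R x) \<le> H * u x\<close>.\<close>
  define H where "H = C * (1/2) powr (- \<eta>) / c"
  have H: "H > 0" using C c by (simp add: H_def)
  \<comment> \<open>The term \<open>2 * G * H\<close> belongs to the endpoint
    \<open>l *\<^sub>R x\<close> (2 from \<open>norm x \<le> 2 * norm (l *\<^sub>R x)\<close>), the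
    term \<open>G\<close> to the endpoint \<open>x\<close>.\<close>
  define L where "L = b * (2 * G * H + G)"
  have L: "L \<ge> 0" using par G H by (simp add: L_def)
  have "\<bar>u (l *\<^sub>R x) - u x\<bar> \<le> L * (1 - l) * u x" if l: "1/2 \<le> l" "l \<le> 1" for x l
  proof (cases "x = 0")
    case True
    then show ?thesis using L l u[of 0] by simp
  next
    case False
    let ?z = "l *\<^sub>R x"
    have z: "?z \<noteq> 0" using False l by simp
    have uz: "u ?z \<le> H * u x"
    proof -
      have "1/2 * norm x \<le> l * norm x" using l by (intro mult_right_mono) auto
      then have "1/2 * (1 + norm x) \<le> 1 + norm ?z" using l by simp
      then have "u ?z \<le> C * (1/2 * (1 + norm x)) powr (- \<eta>)"
        using C(2)[of ?z] C(1) par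
        by (intro order_trans[OF C(2)] mult_left_mono powr_mono2') (auto intro: add_pos_nonneg)
      also have "\<dots> = C * (1/2) powr (- \<eta>) * (1 + norm x) powr (- \<eta>)"
        by (simp only: powr_mult mult.assoc)
      also have "\<dots> \<le> H * u x"
        using mult_left_mono[OF c(2)[of x], of H] H c(1) by (simp add: H_def)
      finally show ?thesis .
    qed
    have xz: "norm (?z - x) = (1 - l) * norm x"
    proof -
      have "?z - x = (l - 1) *\<^sub>R x" by (simp add: scaleR_left_diff_distrib)
      then show ?thesis using l by simp
    qed
    have "norm x * N ?z \<le> 2 * (norm ?z * N ?z)"
      using mult_right_mono[of "1/2" l "norm x * N ?z"] N0[of ?z] l by (simp add: mult.assoc)
    also have "\<dots> \<le> 2 * (G * u ?z)" using N[OF z] by simp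
    also have "\<dots> \<le> 2 * (G * (H * u x))" using uz G by (intro mult_left_mono) auto
    finally have "norm x * (N ?z + N x) \<le> (2 * G * H + G) * u x"
      using N[OF False] by (simp add: algebra_simps)
    then have "(b * (1 - l)) * (norm x * (N ?z + N x)) \<le> (b * (1 - l)) * ((2 * G * H + G) * u x)"
      using par l by (intro mult_left_mono) auto
    then have "b * norm (?z - x) * (N ?z + N x) \<le> L * (1 - l) * u x"
      by (simp add: xz L_def mult_ac)
    then show ?thesis using diff[OF z False] diff[OF False z]
      by (simp add: norm_minus_commute add.commute)
  qed
  then show ?thesis using L by blast
qed

section \<open>Dilations and energies\<close>

text \<open>In the unit ball \<open>u\<close> is bounded and the weight is integrable since
  \<open>\<sigma>\<close> is below the dimension. Outside, the weight is comparable to a power of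
  \<open>1 + norm x\<close>, and the total decay \<open>s * \<eta> + \<sigma>\<close> exceeds the
  dimension.\<close>

lemma weighted_energy_finite:
  fixes u :: "'a::euclidean_space \<Rightarrow> real"
  assumes [measurable]: "u \<in> borel_measurable borel"
    and s: "s > 0" and \<sigma>: "0 \<le> \<sigma>" "\<sigma> < real DIM('a)" and ex: "s * \<eta> + \<sigma> > real DIM('a)" and \<eta>: "\<eta> > 0"
    and u: "\<And>x. u x > 0" and C: "C > 0" "\<And>x. u x \<le> C * (1 + norm x) powr (- \<eta>)"
  shows "(\<integral>\<^sup>+ x. ennreal (u x powr s / norm x powr \<sigma>) \<partial>lborel) < \<infinity>"
proof -
  let ?n = "real DIM('a)"
  define g where "g y = ennreal (norm y powr (- \<sigma>)) * indicator (ball 0 1) y" for y :: 'a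
  have [measurable]: "g \<in> borel_measurable borel"
    unfolding g_def by (intro borel_measurable_times_ennreal borel_measurable_indicator) auto
  define h where "h y = ennreal ((1 + norm y) powr (- (s * \<eta> + \<sigma>)))" for y :: 'a
  have [measurable]: "h \<in> borel_measurable borel" unfolding h_def by measurable
  have fin: "(\<integral>\<^sup>+ y. g y \<partial>lborel) < top" "(\<integral>\<^sup>+ y. h y \<partial>lborel) < top"
  proof -
    obtain B where "(\<integral>\<^sup>+ y. g y \<partial>lborel) \<le> ennreal (B * 1 powr (?n - \<sigma>))"
      unfolding g_def using nn_integral_ball_powr_le[OF \<sigma>] by (metis zero_less_one)
    then show "(\<integral>\<^sup>+ y. g y \<partial>lborel) < top" using ennreal_less_top le_less_trans by blast
    show "(\<integral>\<^sup>+ y. h y \<partial>lborel) < top"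
      unfolding h_def using nn_integral_shifted_norm_powr_finite[OF ex] by simp
  qed
  define K where "K = C powr s"
  have K: "K > 0" using C by (simp add: K_def)
  have "(\<integral>\<^sup>+ x. ennreal (u x powr s / norm x powr \<sigma>) \<partial>lborel)
    \<le> (\<integral>\<^sup>+ x. ennreal K * g x + ennreal (K * 2 powr \<sigma>) * h x \<partial>lborel)"
  proof (rule nn_integral_mono)
    fix x :: 'a
    have "u x powr s \<le> (C * (1 + norm x) powr (- \<eta>)) powr s"
      using s u[of x] C by (intro powr_mono2) auto
    also have "\<dots> = K * (1 + norm x) powr (- (s * \<eta>))"
      by (simp add: powr_mult powr_powr K_def mult.commute)
    finally have us: "u x powr s \<le> K * (1 + norm x) powr (- (s * \<eta>))" .
    have "ennreal (u x powr s / norm x powr \<sigma>) = ennreal (u x powr s * norm x powr (- \<sigma>))"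
      by (simp add: powr_minus field_simps)
    also have "\<dots> \<le> ennreal K * g x + ennreal (K * 2 powr \<sigma>) * h x"
    proof (cases "norm x < 1")
      case True
      have "(1 + norm x) powr (- (s * \<eta>)) \<le> 1 powr (- (s * \<eta>))"
        using s \<eta> by (intro powr_mono2') auto
      from order_trans[OF us mult_left_mono[OF this]] have "u x powr s \<le> K" using K by simp
      then have "u x powr s * norm x powr (- \<sigma>) \<le> K * norm x powr (- \<sigma>)" by (intro mult_right_mono) auto
      then have "ennreal (u x powr s * norm x powr (- \<sigma>)) \<le> ennreal K * g x"
        using True K by (simp add: g_def ennreal_leI flip: ennreal_mult)
      then show ?thesis by (simp add: add_increasing2)
    next
      case False
      have "norm x powr (- \<sigma>) \<le> (1/2 * (1 + norm x)) powr (- \<sigma>)"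
        using False \<sigma> by (intro powr_mono2') (auto intro: add_pos_nonneg)
      also have "\<dots> = 2 powr \<sigma> * (1 + norm x) powr (- \<sigma>)"
        by (subst powr_mult) (simp add: powr_divide powr_minus)
      finally have "u x powr s * norm x powr (- \<sigma>)
        \<le> (K * (1 + norm x) powr (- (s * \<eta>))) * (2 powr \<sigma> * (1 + norm x) powr (- \<sigma>))"
        using us K by (intro mult_mono) auto
      also have "\<dots> = K * 2 powr \<sigma> * (1 + norm x) powr (- (s * \<eta> + \<sigma>))"
        using powr_add[of "1 + norm x" "- (s * \<eta>)" "- \<sigma>"] by simp
      finally have "ennreal (u x powr s * norm x powr (- \<sigma>)) \<le> ennreal (K * 2 powr \<sigma>) * h x"
        using K by (simp add: h_def ennreal_leI flip: ennreal_mult)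
      then show ?thesis by (simp add: add_increasing)
    qed
    finally show "ennreal (u x powr s / norm x powr \<sigma>) \<le> ennreal K * g x + ennreal (K * 2 powr \<sigma>) * h x" .
  qed
  also have "\<dots> = ennreal K * (\<integral>\<^sup>+ x. g x \<partial>lborel) + ennreal (K * 2 powr \<sigma>) * (\<integral>\<^sup>+ x. h x \<partial>lborel)"
    by (simp add: nn_integral_add nn_integral_cmult)
  also have "\<dots> < \<infinity>" using fin by (simp add: ennreal_mult_less_top)
  finally show ?thesis .
qed

lemma weighted_energy_scale:
  fixes u :: "'a::euclidean_space \<Rightarrow> real"
  assumes [measurable]: "u \<in> borel_measurable borel" and l: "l > 0"
    and E: "(\<integral>\<^sup>+ x. ennreal (u x powr s / norm x powr \<sigma>) \<partial>lborel) = ennreal e" and e: "e \<ge> 0"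
  shows "(\<integral>\<^sup>+ x. ennreal (u (l *\<^sub>R x) powr s / norm x powr \<sigma>) \<partial>lborel)
    = ennreal (l powr (\<sigma> - real DIM('a)) * e)"
proof -
  let ?I = "\<integral>\<^sup>+ x. ennreal (u (l *\<^sub>R x) powr s / norm x powr \<sigma>) \<partial>lborel"
  have "ennreal e = ennreal (l ^ DIM('a)) *
      (\<integral>\<^sup>+ x. ennreal (u (l *\<^sub>R x) powr s / norm (l *\<^sub>R x) powr \<sigma>) \<partial>lborel)"
    unfolding E[symmetric] using l by (subst nn_integral_lborel_scale[of _ l]) auto
  also have "(\<lambda>x. ennreal (u (l *\<^sub>R x) powr s / norm (l *\<^sub>R x) powr \<sigma>))
    = (\<lambda>x. ennreal (l powr (- \<sigma>)) * ennreal (u (l *\<^sub>R x) powr s / norm x powr \<sigma>))"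
    using l by (simp add: powr_mult powr_minus field_simps flip: ennreal_mult')
  also have "(\<integral>\<^sup>+ x. ennreal (l powr (- \<sigma>)) * ennreal (u (l *\<^sub>R x) powr s / norm x powr \<sigma>) \<partial>lborel)
    = ennreal (l powr (- \<sigma>)) * ?I"
    by (intro nn_integral_cmult) auto
  finally have "ennreal e = ennreal (l powr (- \<sigma>) * l ^ DIM('a)) * ?I"
    using l by (simp add: ennreal_mult mult_ac)
  then have eq: "ennreal e = ennreal (l powr (real DIM('a) - \<sigma>)) * ?I"
    using powr_mult_power[OF l, of "- \<sigma>" "DIM('a)"] by simp
  have "ennreal (l powr (\<sigma> - real DIM('a)) * e) = ennreal (l powr (\<sigma> - real DIM('a))) * ennreal e"
    using e by (simp add: ennreal_mult)
  also have "\<dots> = ennreal (l powr (\<sigma> - real DIM('a)) * l powr (real DIM('a) - \<sigma>)) * ?I"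
    unfolding eq by (simp add: ennreal_mult mult.assoc)
  also have "l powr (\<sigma> - real DIM('a)) * l powr (real DIM('a) - \<sigma>) = 1"
    using l by (simp flip: powr_add)
  finally show ?thesis by simp
qed

text \<open>Scaling writes \<open>u (l *\<^sub>R x)\<close> as a power of \<open>l\<close> times the
  potential of the dilated density. Symmetry moves the potential onto \<open>u powr p\<close> with
  its weight, and that potential is \<open>v\<close> by the second equation.\<close>

lemma dilation_identity:
  fixes u v :: "'a::euclidean_space \<Rightarrow> real"
  assumes [measurable]: "u \<in> borel_measurable borel" "v \<in> borel_measurable borel"
    and u: "\<And>x. u x > 0" and v: "\<And>x. v x > 0" and l: "l > 0"
    and eq_u: "\<And>x. ennreal (u x) = riesz_pot b (\<lambda>y. v y powr q / norm y powr \<sigma>1) x"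
    and eq_v: "\<And>x. ennreal (v x) = riesz_pot b (\<lambda>y. u y powr p / norm y powr \<sigma>2) x"
  shows "(\<integral>\<^sup>+ x. ennreal (u (l *\<^sub>R x) * u x powr p / norm x powr \<sigma>2) \<partial>lborel)
    = ennreal (l powr (real DIM('a) - b - \<sigma>1)) *
      (\<integral>\<^sup>+ x. ennreal (v (l *\<^sub>R x) powr q * v x / norm x powr \<sigma>1) \<partial>lborel)"
proof -
  let ?g = "\<lambda>y. u y powr p / norm y powr \<sigma>2"
  let ?h = "\<lambda>y. v (l *\<^sub>R y) powr q / norm y powr \<sigma>1"
  let ?c = "ennreal (l powr (real DIM('a) - b - \<sigma>1))"
  have ul: "ennreal (u (l *\<^sub>R x)) = ?c * riesz_pot b ?h x" for x
  proof -
    have "ennreal (u (l *\<^sub>R x)) = ennreal (l powr (real DIM('a) - b)) *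
        riesz_pot b (\<lambda>y. v (l *\<^sub>R y) powr q / norm (l *\<^sub>R y) powr \<sigma>1) x"
      unfolding eq_u by (rule riesz_pot_scale) (use l in auto)
    also have "(\<lambda>y. v (l *\<^sub>R y) powr q / norm (l *\<^sub>R y) powr \<sigma>1) = (\<lambda>y. l powr (- \<sigma>1) * ?h y)"
      using l by (simp add: powr_mult powr_minus field_simps)
    also have "riesz_pot b (\<lambda>y. l powr (- \<sigma>1) * ?h y) x = ennreal (l powr (- \<sigma>1)) * riesz_pot b ?h x"
      by (rule riesz_pot_cmult) auto
    also have "ennreal (l powr (real DIM('a) - b)) * (ennreal (l powr (- \<sigma>1)) * riesz_pot b ?h x)
      = ennreal (l powr (real DIM('a) - b) * l powr (- \<sigma>1)) * riesz_pot b ?h x"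
      by (simp add: ennreal_mult mult.assoc)
    also have "l powr (real DIM('a) - b) * l powr (- \<sigma>1) = l powr (real DIM('a) - b - \<sigma>1)"
      by (simp flip: powr_add)
    finally show ?thesis .
  qed
  have rm: "(\<lambda>x. riesz_pot b ?h x) \<in> borel_measurable borel"
    unfolding riesz_pot_def by measurable
  have "(\<integral>\<^sup>+ x. ennreal (u (l *\<^sub>R x) * u x powr p / norm x powr \<sigma>2) \<partial>lborel)
    = (\<integral>\<^sup>+ x. ennreal (?g x) * ennreal (u (l *\<^sub>R x)) \<partial>lborel)"
    using u by (intro nn_integral_cong) (simp add: less_imp_le mult.commute flip: ennreal_mult)
  also have "\<dots> = (\<integral>\<^sup>+ x. ?c * (ennreal (?g x) * riesz_pot b ?h x) \<partial>lborel)"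
    unfolding ul by (simp add: mult_ac)
  also have "\<dots> = ?c * (\<integral>\<^sup>+ x. ennreal (?g x) * riesz_pot b ?h x \<partial>lborel)"
    using rm by (intro nn_integral_cmult) auto
  also have "(\<integral>\<^sup>+ x. ennreal (?g x) * riesz_pot b ?h x \<partial>lborel) = (\<integral>\<^sup>+ x. ennreal (?h x) * ennreal (v x) \<partial>lborel)"
    unfolding eq_v by (rule riesz_pot_symmetric) auto
  also have "\<dots> = (\<integral>\<^sup>+ x. ennreal (v (l *\<^sub>R x) powr q * v x / norm x powr \<sigma>1) \<partial>lborel)"
    using v by (intro nn_integral_cong) (simp add: less_imp_le flip: ennreal_mult)
  finally show ?thesis .
qed

section \<open>Young's inequality and its quadratic deficit\<close>

lemma young_product_le:
  fixes a c q :: real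
  assumes "a > 0" "c > 0" "q > 0"
  shows "a powr q * c \<le> q / (q + 1) * a powr (q + 1) + 1 / (q + 1) * c powr (q + 1)"
  using Youngs_inequality_0[of "q / (q + 1)" "1 / (q + 1)" "a powr (q + 1)" "c powr (q + 1)"] assms
  by (simp add: powr_powr add_divide_distrib[symmetric])

text \<open>A reverse Young inequality. With \<open>t = a / c\<close> the deficit is
  \<open>(t powr (p + 1) + p) / (p + 1) - t\<close>; it vanishes at \<open>t = 1\<close> together
  with its derivative \<open>t powr p - 1\<close>, so it is quadratic in \<open>t - 1\<close> on the
  compact range of \<open>t\<close>.\<close>

lemma young_deficit_le:
  fixes p :: real
  assumes p: "p > 0"
  shows "\<exists>M\<ge>0. \<forall>a>0. \<forall>c>0. \<bar>a - c\<bar> \<le> c / 2 \<longrightarrow>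
    (a powr (p + 1) + p * c powr (p + 1)) / (p + 1) \<le> a * c powr p + M * ((a - c) / c)\<^sup>2 * c powr (p + 1)"
proof -
  \<comment> \<open>Bounds the derivative of \<open>t powr p\<close> between \<open>1/2\<close> and
    \<open>3/2\<close>. Both endpoints occur because the monotonicity of
    \<open>z powr (p - 1)\<close> changes at \<open>p = 1\<close>.\<close>
  define M where "M = p * ((1/2) powr (p - 1) + (3/2) powr (p - 1))"
  have M: "M \<ge> 0" using p by (simp add: M_def)
  have 1: "\<bar>t powr p - 1\<bar> \<le> M * \<bar>t - 1\<bar>" if t: "1/2 \<le> t" "t \<le> 3/2" for t :: real
  proof -
    have "norm (t powr p - 1 powr p) \<le> M * norm (t - 1)"
    proof (rule field_differentiable_bound[where S = "{1/2..3/2}" and f' = "\<lambda>x. p * x powr (p - 1)"])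
      fix z :: real assume z: "z \<in> {1/2..3/2}"
      then show "((\<lambda>x. x powr p) has_field_derivative p * z powr (p - 1)) (at z within {1/2..3/2})"
        by (auto intro!: derivative_eq_intros)
      have "z powr (p - 1) \<le> (1/2) powr (p - 1) + (3/2) powr (p - 1)"
      proof (cases "p \<ge> 1")
        case True
        then have "z powr (p - 1) \<le> (3/2) powr (p - 1)" using z by (intro powr_mono2) auto
        then show ?thesis by (simp add: add_increasing)
      next
        case False
        then have "z powr (p - 1) \<le> (1/2) powr (p - 1)" using z by (intro powr_mono2') auto
        then show ?thesis by (simp add: add_increasing2)
      qed
      then show "norm (p * z powr (p - 1)) \<le> M" using p by (simp add: M_def abs_mult)
    qed (use t in auto)
    then show ?thesis by simp
  qed
  have 2: "(t powr (p + 1) + p) / (p + 1) \<le> t + M * (t - 1)\<^sup>2" if t: "1/2 \<le> t" "t \<le> 3/2" for t :: real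
  proof -
    let ?h = "\<lambda>t. (t powr (p + 1) + p) / (p + 1) - t"
    have seg: "\<bar>z - 1\<bar> \<le> \<bar>t - 1\<bar>" "1/2 \<le> z" "z \<le> 3/2" if "z \<in> closed_segment 1 t" for z
      using that t by (auto simp: closed_segment_eq_real_ivl split: if_splits)
    have "norm (?h t - ?h 1) \<le> (M * \<bar>t - 1\<bar>) * norm (t - 1)"
    proof (rule field_differentiable_bound[where S = "closed_segment 1 t" and f' = "\<lambda>z. z powr p - 1"])
      fix z assume z: "z \<in> closed_segment 1 t"
      have "((\<lambda>t. t powr (p + 1)) has_field_derivative (p + 1) * z powr p) (at z within closed_segment 1 t)"
        using seg[OF z] by (auto intro!: derivative_eq_intros)
      then have "(?h has_field_derivative ((p + 1) * z powr p + 0) / (p + 1) - 1) (at z within closed_segment 1 t)"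
        by (intro DERIV_diff DERIV_cdivide DERIV_add) (auto intro: derivative_intros)
      then show "(?h has_field_derivative z powr p - 1) (at z within closed_segment 1 t)"
        using p by simp
      show "norm (z powr p - 1) \<le> M * \<bar>t - 1\<bar>"
        using 1[of z] seg[OF z] M mult_left_mono[of "\<bar>z - 1\<bar>" "\<bar>t - 1\<bar>" M] by simp
    qed auto
    moreover have "?h 1 = 0" using p by (simp add: add.commute)
    ultimately have "?h t \<le> M * \<bar>t - 1\<bar> * \<bar>t - 1\<bar>" unfolding real_norm_def by linarith
    then show ?thesis by (simp add: power2_eq_square mult.assoc)
  qed
  have "(a powr (p + 1) + p * c powr (p + 1)) / (p + 1) \<le> a * c powr p + M * ((a - c) / c)\<^sup>2 * c powr (p + 1)"
    if ac: "a > 0" "c > 0" "\<bar>a - c\<bar> \<le> c / 2" for a c :: real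
  proof -
    define t where "t = a / c"
    have a: "a = t * c" and t: "1/2 \<le> t" "t \<le> 3/2"
      using ac by (auto simp: t_def field_simps) (smt (verit))+
    have "(a powr (p + 1) + p * c powr (p + 1)) / (p + 1) = (t powr (p + 1) + p) / (p + 1) * c powr (p + 1)"
      by (simp add: a powr_mult field_simps)
    also have "\<dots> \<le> (t + M * (t - 1)\<^sup>2) * c powr (p + 1)"
      using 2[OF t] by (intro mult_right_mono) auto
    also have "\<dots> = a * c powr p + M * ((a - c) / c)\<^sup>2 * c powr (p + 1)"
    proof -
      have "t - 1 = (a - c) / c" using ac by (simp add: t_def field_simps)
      moreover have "t * c powr (p + 1) = a * c powr p" using ac by (simp add: a powr_add)
      ultimately show ?thesis by (simp add: distrib_right)
    qed
    finally show ?thesis .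
  qed
  then show ?thesis using M by blast
qed

text \<open>The dilation identity is squeezed between Young's inequality on the \<open>v\<close>
  side and its reverse on the \<open>u\<close> side. All integrals become multiples of one positive
  finite energy, which cancels and leaves a scalar inequality in \<open>l\<close>.\<close>

lemma lane_emden_dilation_inequality:
  fixes u v :: "'a::euclidean_space \<Rightarrow> real"
  assumes [measurable]: "u \<in> borel_measurable borel" "v \<in> borel_measurable borel"
    and u: "\<And>x. u x > 0" and v: "\<And>x. v x > 0" and p: "p > 0" and q: "q > 0"
    and eq_u: "\<And>x. ennreal (u x) = riesz_pot b (\<lambda>y. v y powr q / norm y powr \<sigma>1) x"
    and eq_v: "\<And>x. ennreal (v x) = riesz_pot b (\<lambda>y. u y powr p / norm y powr \<sigma>2) x"
    and fin: "(\<integral>\<^sup>+ x. ennreal (u x powr (p + 1) / norm x powr \<sigma>2) \<partial>lborel) < \<infinity>"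
    and L: "L \<ge> 0" "\<And>x l. 1/2 \<le> l \<Longrightarrow> l \<le> 1 \<Longrightarrow> \<bar>u (l *\<^sub>R x) - u x\<bar> \<le> L * (1 - l) * u x"
  shows "\<exists>M \<delta>. \<delta> > 0 \<and> (\<forall>l. 1 - \<delta> < l \<longrightarrow> l \<le> 1 \<longrightarrow>
     (l powr (\<sigma>2 - real DIM('a)) + p) / (p + 1)
       \<le> l powr (real DIM('a) - b - \<sigma>1) * ((q * l powr (\<sigma>1 - real DIM('a)) + 1) / (q + 1)) + M * (1 - l)\<^sup>2)"
proof -
  let ?n = "real DIM('a)"
  obtain e where e0: "e \<ge> 0"
    and Eu: "(\<integral>\<^sup>+ x. ennreal (u x powr (p + 1) / norm x powr \<sigma>2) \<partial>lborel) = ennreal e"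
    using fin by (auto simp: less_top_ennreal)
  \<comment> \<open>The integrand is positive except possibly at the origin, where division by zero
    may make it vanish.\<close>
  have e: "e > 0"
  proof (rule ccontr)
    assume "\<not> e > 0"
    then have "AE x in lborel. ennreal (u x powr (p + 1) / norm x powr \<sigma>2) = 0"
      using Eu e0 nn_integral_0_iff_AE[of "\<lambda>x. ennreal (u x powr (p + 1) / norm x powr \<sigma>2)" lborel]
      by auto
    then have "AE x in (lborel :: 'a measure). False"
      using AE_lborel_singleton[of 0]
    proof eventually_elim
      case (elim x)
      then show ?case using u[of x] by (simp add: ennreal_eq_0_iff divide_le_0_iff)
    qed
    then show False by (simp add: eventually_False ae_filter_eq_bot_iff emeasure_lborel_UNIV)
  qed
  note dil = dilation_identity[OF assms(1,2) u v _ eq_u eq_v]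
  \<comment> \<open>The dilation identity at \<open>l = 1\<close> says that the two energies agree,
    so the energy of \<open>v\<close> is finite as well.\<close>
  have Ev: "(\<integral>\<^sup>+ x. ennreal (v x powr (q + 1) / norm x powr \<sigma>1) \<partial>lborel) = ennreal e"
    using dil[of 1] u v by (simp add: Eu[symmetric] powr_add mult.commute less_imp_le)
  obtain M where M: "M \<ge> 0" and young: "\<And>a c. a > 0 \<Longrightarrow> c > 0 \<Longrightarrow> \<bar>a - c\<bar> \<le> c / 2 \<Longrightarrow>
    (a powr (p + 1) + p * c powr (p + 1)) / (p + 1) \<le> a * c powr p + M * ((a - c) / c)\<^sup>2 * c powr (p + 1)"
    using young_deficit_le[OF p] by blast
  \<comment> \<open>The bound \<open>1/2\<close> keeps \<open>l\<close> in the range of the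
    Lipschitz estimate. The other one gives \<open>L * (1 - l) \<le> 1/2\<close>, the closeness
    required by the reverse Young inequality; \<open>L + 1\<close> avoids division by zero.\<close>
  define \<delta> where "\<delta> = min (1/2) (1 / (2 * (L + 1)))"
  have \<delta>: "\<delta> > 0" using L by (simp add: \<delta>_def)
  have main: "(l powr (\<sigma>2 - ?n) + p) / (p + 1)
       \<le> l powr (?n - b - \<sigma>1) * ((q * l powr (\<sigma>1 - ?n) + 1) / (q + 1)) + M * L\<^sup>2 * (1 - l)\<^sup>2"
    if l: "1 - \<delta> < l" "l \<le> 1" for l
  proof -
    have l0: "1/2 \<le> l" "l > 0" using l by (auto simp: \<delta>_def)
    have Ll: "L * (1 - l) \<le> 1/2"
    proof -
      have "L * (1 - l) \<le> L * (1 / (2 * (L + 1)))"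
        using l L by (intro mult_left_mono) (auto simp: \<delta>_def)
      also have "\<dots> \<le> 1/2" using L by (simp add: field_simps)
      finally show ?thesis .
    qed
    define A where "A = (\<integral>\<^sup>+ x. ennreal (u (l *\<^sub>R x) * u x powr p / norm x powr \<sigma>2) \<partial>lborel)"
    define B where "B = (\<integral>\<^sup>+ x. ennreal (v (l *\<^sub>R x) powr q * v x / norm x powr \<sigma>1) \<partial>lborel)"
    have AB: "A = ennreal (l powr (?n - b - \<sigma>1)) * B"
      unfolding A_def B_def by (rule dil[OF l0(2)])
    have "B \<le> (\<integral>\<^sup>+ x. ennreal (q / (q + 1)) * ennreal (v (l *\<^sub>R x) powr (q + 1) / norm x powr \<sigma>1)
        + ennreal (1 / (q + 1)) * ennreal (v x powr (q + 1) / norm x powr \<sigma>1) \<partial>lborel)"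
      unfolding B_def
    proof (rule nn_integral_mono)
      fix x
      have "v (l *\<^sub>R x) powr q * v x / norm x powr \<sigma>1
        \<le> (q / (q + 1) * v (l *\<^sub>R x) powr (q + 1) + 1 / (q + 1) * v x powr (q + 1)) / norm x powr \<sigma>1"
        using young_product_le[of "v (l *\<^sub>R x)" "v x" q] v q by (intro divide_right_mono) auto
      also have "\<dots> = q / (q + 1) * (v (l *\<^sub>R x) powr (q + 1) / norm x powr \<sigma>1)
          + 1 / (q + 1) * (v x powr (q + 1) / norm x powr \<sigma>1)"
        by (simp add: add_divide_distrib)
      finally show "ennreal (v (l *\<^sub>R x) powr q * v x / norm x powr \<sigma>1)
        \<le> ennreal (q / (q + 1)) * ennreal (v (l *\<^sub>R x) powr (q + 1) / norm x powr \<sigma>1)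
          + ennreal (1 / (q + 1)) * ennreal (v x powr (q + 1) / norm x powr \<sigma>1)"
        using q by (subst ennreal_mult[symmetric], simp, simp)+
          (subst ennreal_plus[symmetric], simp, simp, rule ennreal_leI)
    qed
    also have "\<dots> = ennreal (q / (q + 1)) * ennreal (l powr (\<sigma>1 - ?n) * e) + ennreal (1 / (q + 1)) * ennreal e"
      by (simp add: nn_integral_add nn_integral_cmult weighted_energy_scale[OF assms(2) l0(2) Ev e0] Ev)
    also have "\<dots> = ennreal ((q * l powr (\<sigma>1 - ?n) + 1) / (q + 1) * e)"
      using q e0 by (simp add: add_divide_distrib distrib_right flip: ennreal_mult ennreal_plus)
    finally have "A \<le> ennreal (l powr (?n - b - \<sigma>1)) * ennreal ((q * l powr (\<sigma>1 - ?n) + 1) / (q + 1) * e)"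
      unfolding AB by (intro mult_left_mono) auto
    also have "\<dots> = ennreal (l powr (?n - b - \<sigma>1) * ((q * l powr (\<sigma>1 - ?n) + 1) / (q + 1)) * e)"
      using q e0 by (simp add: mult.assoc flip: ennreal_mult)
    finally have A: "A \<le> ennreal (l powr (?n - b - \<sigma>1) * ((q * l powr (\<sigma>1 - ?n) + 1) / (q + 1)) * e)" .
    define k where "k = M * L\<^sup>2 * (1 - l)\<^sup>2"
    have k: "k \<ge> 0" using M by (simp add: k_def)
    \<comment> \<open>Lower bound for \<open>A\<close>: the left side is the integral of the Young
      majorant of \<open>u (l *\<^sub>R x) * u x powr p\<close>, and passing to the product itself
      costs at most \<open>k\<close> times the energy.\<close>
    have "ennreal ((l powr (\<sigma>2 - ?n) + p) / (p + 1) * e)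
      = ennreal (1 / (p + 1)) * ennreal (l powr (\<sigma>2 - ?n) * e) + ennreal (p / (p + 1)) * ennreal e"
      using p e0 by (simp add: add_divide_distrib distrib_right flip: ennreal_mult ennreal_plus)
    also have "\<dots> = (\<integral>\<^sup>+ x. ennreal (1 / (p + 1)) * ennreal (u (l *\<^sub>R x) powr (p + 1) / norm x powr \<sigma>2)
        + ennreal (p / (p + 1)) * ennreal (u x powr (p + 1) / norm x powr \<sigma>2) \<partial>lborel)"
      by (simp add: nn_integral_add nn_integral_cmult weighted_energy_scale[OF assms(1) l0(2) Eu e0] Eu)
    also have "\<dots> \<le> (\<integral>\<^sup>+ x. ennreal (u (l *\<^sub>R x) * u x powr p / norm x powr \<sigma>2)
        + ennreal k * ennreal (u x powr (p + 1) / norm x powr \<sigma>2) \<partial>lborel)"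
    proof (rule nn_integral_mono)
      fix x
      let ?a = "u (l *\<^sub>R x)" and ?c = "u x" and ?N = "norm x powr \<sigma>2"
      have lip: "\<bar>?a - ?c\<bar> \<le> L * (1 - l) * ?c" using L l0 l by blast
      have half: "\<bar>?a - ?c\<bar> \<le> ?c / 2"
        using order_trans[OF lip mult_right_mono[OF Ll, of ?c]] u[of x] by simp
      have "\<bar>(?a - ?c) / ?c\<bar> \<le> L * (1 - l)"
        using lip u[of x] by (simp add: field_simps)
      then have "((?a - ?c) / ?c)\<^sup>2 \<le> (L * (1 - l))\<^sup>2" by (rule abs_le_square_iff[THEN iffD1, OF order_trans]) simp
      then have "M * ((?a - ?c) / ?c)\<^sup>2 * ?c powr (p + 1) \<le> k * ?c powr (p + 1)"
        using mult_left_mono[OF _ M] by (intro mult_right_mono) (auto simp: k_def power_mult_distrib mult.assoc)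
      then have "(?a powr (p + 1) + p * ?c powr (p + 1)) / (p + 1) \<le> ?a * ?c powr p + k * ?c powr (p + 1)"
        using young[OF u u half] by linarith
      then have "(?a powr (p + 1) + p * ?c powr (p + 1)) / (p + 1) / ?N \<le> (?a * ?c powr p + k * ?c powr (p + 1)) / ?N"
        by (intro divide_right_mono) auto
      then have "1 / (p + 1) * (?a powr (p + 1) / ?N) + p / (p + 1) * (?c powr (p + 1) / ?N)
         \<le> ?a * ?c powr p / ?N + k * (?c powr (p + 1) / ?N)"
        by (simp add: add_divide_distrib)
      from ennreal_leI[OF this]
      show "ennreal (1 / (p + 1)) * ennreal (?a powr (p + 1) / ?N) + ennreal (p / (p + 1)) * ennreal (?c powr (p + 1) / ?N)
        \<le> ennreal (?a * ?c powr p / ?N) + ennreal k * ennreal (?c powr (p + 1) / ?N)"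
        using p k u[of "l *\<^sub>R x"] by (simp add: less_imp_le flip: ennreal_mult ennreal_plus)
    qed
    also have "\<dots> = A + ennreal k * ennreal e"
      by (simp add: nn_integral_add nn_integral_cmult A_def Eu)
    also have "\<dots> \<le> ennreal (l powr (?n - b - \<sigma>1) * ((q * l powr (\<sigma>1 - ?n) + 1) / (q + 1)) * e) + ennreal k * ennreal e"
      by (intro add_right_mono A)
    also have "\<dots> = ennreal ((l powr (?n - b - \<sigma>1) * ((q * l powr (\<sigma>1 - ?n) + 1) / (q + 1)) + k) * e)"
      using q e0 k by (simp add: distrib_right flip: ennreal_mult ennreal_plus)
    finally have "(l powr (\<sigma>2 - ?n) + p) / (p + 1) * e
        \<le> (l powr (?n - b - \<sigma>1) * ((q * l powr (\<sigma>1 - ?n) + 1) / (q + 1)) + k) * e"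
      by (rule ennreal_le_iff[THEN iffD1, rotated]) (use q k e0 in simp)
    from mult_right_le_imp_le[OF this e] show ?thesis unfolding k_def .
  qed
  then show ?thesis using \<delta> by blast
qed

section \<open>From the scalar inequality to the exponents\<close>

text \<open>Both sides equal 1 at \<open>l = 1\<close>, so the derivative there of left side minus
  right side cannot be negative. The quadratic error does not contribute to it, and it equals
  \<open>b\<close> minus the sum in the conclusion.\<close>

lemma dilation_inequality_exponents:
  fixes p q n b \<sigma>1 \<sigma>2 M \<delta> :: real
  assumes p: "p > 0" and q: "q > 0" and \<delta>: "\<delta> > 0"
    and ineq: "\<And>l. 1 - \<delta> < l \<Longrightarrow> l \<le> 1 \<Longrightarrow> (l powr (\<sigma>2 - n) + p) / (p + 1)
       \<le> l powr (n - b - \<sigma>1) * ((q * l powr (\<sigma>1 - n) + 1) / (q + 1)) + M * (1 - l)\<^sup>2"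
  shows "(n - \<sigma>1) / (1 + q) + (n - \<sigma>2) / (1 + p) \<le> b"
proof (rule ccontr)
  define F where "F l = (l powr (\<sigma>2 - n) + p) / (p + 1)
       - (l powr (n - b - \<sigma>1) * ((q * l powr (\<sigma>1 - n) + 1) / (q + 1)) + M * (1 - l)\<^sup>2)" for l :: real
  define D where "D = (\<sigma>2 - n) / (p + 1) - ((n - b - \<sigma>1) + q * (\<sigma>1 - n) / (q + 1))"
  assume "\<not> (n - \<sigma>1) / (1 + q) + (n - \<sigma>2) / (1 + p) \<le> b"
  moreover have "D = b - ((n - \<sigma>1) / (1 + q) + (n - \<sigma>2) / (1 + p))"
    using p q by (simp add: D_def divide_simps) (simp add: algebra_simps)
  ultimately have D: "D < 0" by simp
  have d1: "((\<lambda>l. (l powr (\<sigma>2 - n) + p) / (p + 1)) has_field_derivative (\<sigma>2 - n) / (p + 1)) (at 1)"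
    using p by (auto intro!: derivative_eq_intros)
  have d2: "((\<lambda>l. l powr (n - b - \<sigma>1)) has_field_derivative n - b - \<sigma>1) (at 1)"
    by (auto intro!: derivative_eq_intros)
  have d3: "((\<lambda>l. (q * l powr (\<sigma>1 - n) + 1) / (q + 1)) has_field_derivative q * (\<sigma>1 - n) / (q + 1)) (at 1)"
    using q by (auto intro!: derivative_eq_intros)
  have d4: "((\<lambda>l. M * (1 - l)\<^sup>2) has_field_derivative 0) (at 1)"
    by (auto intro!: derivative_eq_intros)
  have "(F has_field_derivative D) (at 1)"
    using DERIV_diff[OF d1 DERIV_add[OF DERIV_mult[OF d2 d3] d4]] q by (simp add: F_def[abs_def] D_def)
  \<comment> \<open>A negative derivative would make \<open>F\<close> positive just to the left of
    1, against the assumed inequality.\<close>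
  from DERIV_neg_dec_left[OF this D] obtain d where d: "d > 0"
    and dec: "\<And>h. h > 0 \<Longrightarrow> h < d \<Longrightarrow> F 1 < F (1 - h)" by blast
  define h where "h = min d \<delta> / 2"
  have h: "h > 0" "h < d" "h < \<delta>" using d \<delta> by (auto simp: h_def)
  have "F 1 = 0" using p q by (simp add: F_def add.commute)
  moreover have "F (1 - h) \<le> 0" using ineq[of "1 - h"] h by (simp add: F_def)
  ultimately show False using dec[OF h(1,2)] by simp
qed

text \<open>Adding \<open>\<theta>2\<close> to the first inequality and \<open>\<theta>1\<close> to
  the second bounds each exponent below in terms of the sum \<open>S\<close>. Adding these gives a
  lower bound for \<open>S * k\<close>; subcriticality says that \<open>(n - \<alpha>) * k\<close>
  lies strictly below the same quantity, and \<open>k > 0\<close> is equivalent to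
  \<open>p * q > 1\<close>.\<close>

lemma subcritical_decay_exponents:
  fixes p q n \<alpha> \<sigma>1 \<sigma>2 \<theta>1 \<theta>2 :: real
  assumes pq: "p > 0" "q > 0" "p * q > 1"
    and sub: "(n - \<sigma>1) / (1 + q) + (n - \<sigma>2) / (1 + p) > n - \<alpha>"
    and t1: "\<theta>1 \<le> q * \<theta>2 + \<sigma>1 - \<alpha>" and t2: "\<theta>2 \<le> p * \<theta>1 + \<sigma>2 - \<alpha>"
  shows "\<theta>1 + \<theta>2 > n - \<alpha>"
proof -
  define S where "S = \<theta>1 + \<theta>2"
  define k where "k = 1 - 1 / (1 + p) - 1 / (1 + q)"
  have k: "k > 0"
  proof -
    have "k = (p * q - 1) / ((1 + p) * (1 + q))" using pq by (simp add: k_def field_simps)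
    then show ?thesis using pq by simp
  qed
  have "\<theta>1 \<ge> (S + \<alpha> - \<sigma>2) / (1 + p)" "\<theta>2 \<ge> (S + \<alpha> - \<sigma>1) / (1 + q)"
    using t1 t2 pq by (auto simp: S_def field_simps)
  then have "S \<ge> (S + \<alpha> - \<sigma>2) / (1 + p) + (S + \<alpha> - \<sigma>1) / (1 + q)" unfolding S_def by linarith
  then have 1: "S * k \<ge> (\<alpha> - \<sigma>2) / (1 + p) + (\<alpha> - \<sigma>1) / (1 + q)"
    by (simp add: k_def algebra_simps add_divide_distrib diff_divide_distrib)
  have "(n - \<alpha>) * k < (\<alpha> - \<sigma>2) / (1 + p) + (\<alpha> - \<sigma>1) / (1 + q)"
    using sub by (simp add: k_def algebra_simps add_divide_distrib diff_divide_distrib)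
  with 1 have "(n - \<alpha>) * k < S * k" by linarith
  then show ?thesis using k by (simp add: S_def)
qed

theorem theorem1p2:
  fixes p q \<alpha> \<sigma>1 \<sigma>2 :: real
  assumes n3: "CARD('n::finite) \<ge> 3"
    and pq: "p > 0" "q > 0" "p * q > 1"
    and alpha: "1 < \<alpha>" "\<alpha> < real CARD('n)"
    and sig1: "0 \<le> \<sigma>1" "\<sigma>1 < \<alpha>"
    and sig2: "0 \<le> \<sigma>2" "\<sigma>2 < \<alpha>"
    and subcrit: "(real CARD('n) - \<sigma>1) / (1 + q) + (real CARD('n) - \<sigma>2) / (1 + p)
                    > real CARD('n) - \<alpha>"
  shows "\<not> (\<exists>(u :: real^'n \<Rightarrow> real) (v :: real^'n \<Rightarrow> real).
      classical_fn \<alpha> u \<and> classical_fn \<alpha> v \<and>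
      (\<forall>x. u x > 0) \<and> (\<forall>x. v x > 0) \<and>
      bounded (range u) \<and> bounded (range v) \<and>
      (\<exists>\<theta>1 \<theta>2. \<theta>1 > 0 \<and> \<theta>2 > 0 \<and> decays_like u \<theta>1 \<and> decays_like v \<theta>2) \<and>
      (\<forall>x. ennreal (u x) = (\<integral>\<^sup>+ y. ennreal (v y powr q /
              (norm (x - y) powr (real CARD('n) - \<alpha>) * norm y powr \<sigma>1)) \<partial>lborel)) \<and>
      (\<forall>x. ennreal (v x) = (\<integral>\<^sup>+ y. ennreal (u y powr p /
              (norm (x - y) powr (real CARD('n) - \<alpha>) * norm y powr \<sigma>2)) \<partial>lborel)))"
proof (rule notI, elim exE conjE)
  fix u v :: "real^'n \<Rightarrow> real" and \<theta>1 \<theta>2 :: real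
  define b where "b = real CARD('n) - \<alpha>"
  have n: "DIM(real^'n) = CARD('n)" by simp
  assume "classical_fn \<alpha> u" "classical_fn \<alpha> v"
  then have cont: "continuous_on UNIV u" "continuous_on UNIV v" by (auto simp: classical_fn_def)
  then have meas: "u \<in> borel_measurable borel" "v \<in> borel_measurable borel"
    by (auto intro: borel_measurable_continuous_onI)
  assume "\<forall>x. u x > 0" "\<forall>x. v x > 0"
  then have u: "\<And>x. u x > 0" and v: "\<And>x. v x > 0" by auto
  assume \<theta>: "\<theta>1 > 0" "\<theta>2 > 0" and dec: "decays_like u \<theta>1" "decays_like v \<theta>2"
  assume "\<forall>x. ennreal (u x) = (\<integral>\<^sup>+ y. ennreal (v y powr q /
              (norm (x - y) powr (real CARD('n) - \<alpha>) * norm y powr \<sigma>1)) \<partial>lborel)"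
  then have eq_u: "\<And>x. ennreal (u x) = riesz_pot b (\<lambda>y. v y powr q / norm y powr \<sigma>1) x"
    by (simp add: riesz_pot_def b_def mult.commute)
  assume "\<forall>x. ennreal (v x) = (\<integral>\<^sup>+ y. ennreal (u y powr p /
              (norm (x - y) powr (real CARD('n) - \<alpha>) * norm y powr \<sigma>2)) \<partial>lborel)"
  then have eq_v: "\<And>x. ennreal (v x) = riesz_pot b (\<lambda>y. u y powr p / norm y powr \<sigma>2) x"
    by (simp add: riesz_pot_def b_def mult.commute)
  \<comment> \<open>The second inequality is the hypothesis \<open>\<alpha> > 1\<close>.\<close>
  have b: "b > 0" "b + 1 < real DIM(real^'n)" "real DIM(real^'n) - b = \<alpha>"
    using alpha by (auto simp: b_def)
  obtain cu Cu where cu: "cu > 0" "\<And>x. cu * (1 + norm x) powr (- \<theta>1) \<le> u x"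
    and Cu: "Cu > 0" "\<And>x. u x \<le> Cu * (1 + norm x) powr (- \<theta>1)"
    using decays_like_bounds[OF dec(1) \<theta>(1) cont(1) u] by metis
  obtain cv Cv where cv: "cv > 0" "\<And>x. cv * (1 + norm x) powr (- \<theta>2) \<le> v x"
    and Cv: "Cv > 0" "\<And>x. v x \<le> Cv * (1 + norm x) powr (- \<theta>2)"
    using decays_like_bounds[OF dec(2) \<theta>(2) cont(2) v] by metis
  have t1: "\<theta>1 \<le> q * \<theta>2 + \<sigma>1 - (real DIM(real^'n) - b)"
    using pq \<theta> sig1 b by (intro riesz_pot_decay_exponent[OF _ _ _ _ _ cv Cu eq_u]) auto
  have t2: "\<theta>2 \<le> p * \<theta>1 + \<sigma>2 - (real DIM(real^'n) - b)"
    using pq \<theta> sig2 b by (intro riesz_pot_decay_exponent[OF _ _ _ _ _ cu Cv eq_v]) auto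
  have "\<theta>1 + \<theta>2 > real CARD('n) - \<alpha>"
    using subcritical_decay_exponents[OF pq subcrit] t1 t2 b(3) by simp
  \<comment> \<open>Since \<open>p * \<theta>1 + \<sigma>2 \<ge> \<theta>2 + \<alpha>\<close>, the
    left side is at least \<open>\<theta>1 + \<theta>2 + \<alpha>\<close>, which exceeds the
    dimension.\<close>
  then have ex: "(p + 1) * \<theta>1 + \<sigma>2 > real DIM(real^'n)"
    using t2 b(3) by (simp add: algebra_simps)
  have fin: "(\<integral>\<^sup>+ x. ennreal (u x powr (p + 1) / norm x powr \<sigma>2) \<partial>lborel) < \<infinity>"
    using pq sig2 alpha by (intro weighted_energy_finite[OF meas(1) _ _ _ ex \<theta>(1) u Cu]) auto
  obtain L where L: "L \<ge> 0"
    "\<And>x l. 1/2 \<le> l \<Longrightarrow> l \<le> 1 \<Longrightarrow> \<bar>u (l *\<^sub>R x) - u x\<bar> \<le> L * (1 - l) * u x"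
    using riesz_pot_dilation_lipschitz[OF pq(2) \<theta>(2,1) sig1(1) _ b(1,2) meas(2) v u Cv cu Cu eq_u t1]
      sig1(2) b(3) by auto
  obtain M \<delta> where "\<delta> > 0" "\<And>l. 1 - \<delta> < l \<Longrightarrow> l \<le> 1 \<Longrightarrow>
     (l powr (\<sigma>2 - real CARD('n)) + p) / (p + 1)
       \<le> l powr (real CARD('n) - b - \<sigma>1) * ((q * l powr (\<sigma>1 - real CARD('n)) + 1) / (q + 1)) + M * (1 - l)\<^sup>2"
    using lane_emden_dilation_inequality[OF meas u v pq(1,2) eq_u eq_v fin L] unfolding n by metis
  then have "(real CARD('n) - \<sigma>1) / (1 + q) + (real CARD('n) - \<sigma>2) / (1 + p) \<le> b"
    using dilation_inequality_exponents[OF pq(1,2)] by metis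
  then show False using subcrit by (simp add: b_def)
qed

end
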